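(* Let $p_0\in(0,1)$, $p_1,p_2\in(0.5,1]$ and $1\le x_L<x_U<\infty$. There is exactly one $D_s$-optimal design $\xi_s$ on $[x_L,x_U]$ for estimating the prevalence $p_0$ alone, that is, exactly one design maximizing $\Phi_s[M(\xi)]=-\log\left(M(\xi)^{-}\right)_{11}$ among all designs under which $p_0$ is estimable. It has exactly three group sizes $x_L<x_2^s<x_U$, where $$x_2^s-x_L=\frac{\log(A_s)}{\log(1-p_0)}$$ and $A_s$ is the unique solution $a\in(r,1)$ of the equation $$\frac{2\left(1+\Delta_1(a)\right)}{a}\left(1+\frac{1+\Delta_0\cdot\frac1a}{\log(a)-\Delta_0\left(\frac1a-1\right)}\right)=\frac{1}{\delta c+a}-\frac{1}{c-a}+2\Delta_2(a).$$ Its weights at $x_1=x_L$, $x_2=x_2^s$, $x_3=x_U$ are $$w_i^s=\frac{Q_i(x_1,x_2,x_3)^{1/2}}{\sum_{j=1}^3Q_j(x_1,x_2,x_3)^{1/2}},\qquad i=1,2,3.$$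
   Context: Group testing model: $p_0$, $p_1$, $p_2$ are the prevalence, sensitivity and specificity, and $\theta=(p_0,p_1,p_2)^{\mathrm T}$. The probability of a positive response for a trial with group size $x$ is $$\pi(x)=p_1-(p_1+p_2-1)(1-p_0)^x .$$ Group sizes $x$ are real numbers in $[x_L,x_U]$. An (approximate) design is a finitely supported probability measure on $[x_L,x_U]$, written $\xi=\{(x_i,w_i)\}_{i=1}^k$, with $k\ge1$ arbitrary, distinct group sizes (support points) $x_1<\cdots<x_k$ in $[x_L,x_U]$ and weights $w_i>0$, $\sum_i w_i=1$. Its Fisher information matrix is the $3\times3$ matrix $$M(\xi)=\sum_{i=1}^k w_i\lambda(x_i)f(x_i)f(x_i)^{\mathrm T},\qquad \lambda(x)=[\pi(x)(1-\pi(x))]^{-1},$$ where $f(x)=(f_0(x),f_1(x),f_2(x))^{\mathrm T}$ is the gradient of $\pi(x)$ in $\theta$: $$f_0(x)=x(p_1+p_2-1)(1-p_0)^{x-1},\quad f_1(x)=1-(1-p_0)^x,\quad f_2(x)=-(1-p_0)^x .$$ The parameter $p_0$ is estimable under $\xi$ if $e_1=(1,0,0)^{\mathrm T}$ lies in the range (column space) of $M(\xi)$. $M^-$ denotes a generalized inverse of $M$ and $(\cdot)_{11}$ the $(1,1)$ entry (when $p_0$ is estimable, $(M(\xi)^-)_{11}=e_1^{\mathrm T}M(\xi)^-e_1$ does not depend on the choice of generalized inverse). Constants: $$c=\frac{p_1}{(p_1+p_2-1)(1-p_0)^{x_L}}>1,\quad \delta=\frac{1-p_1}{p_1}\in[0,1),\quad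 r=(1-p_0)^{x_U-x_L}\in(0,1),\quad \Delta_0=\frac{r\log r}{1-r}.$$ For $a\in(r,1)$: $$\Delta_1(a)=\frac{(a-r)\sqrt{(c-1)(\delta c+1)}+(1-a)\sqrt{(c-r)(\delta c+r)}}{(1-r)\sqrt{(c-a)(\delta c+a)}},$$ $$\Delta_2(a)=\frac{\sqrt{(c-1)(\delta c+1)}-\sqrt{(c-r)(\delta c+r)}}{(1-r)\sqrt{(c-a)(\delta c+a)}}.$$ For $x_1<x_2<x_3$ in $[x_L,x_U]$: $$Q_1(x_1,x_2,x_3)=\lambda(x_1)^{-1}\{(1-p_0)^{x_2}-(1-p_0)^{x_3}\}^2,$$ $$Q_2(x_1,x_2,x_3)=\lambda(x_2)^{-1}\{(1-p_0)^{x_1}-(1-p_0)^{x_3}\}^2,$$ $$Q_3(x_1,x_2,x_3)=\lambda(x_3)^{-1}\{(1-p_0)^{x_1}-(1-p_0)^{x_2}\}^2.$$ *)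

theory Defs
  imports "HOL-Probability.Probability"
begin

definition resp_prob :: "real \<Rightarrow> real \<Rightarrow> real \<Rightarrow> real \<Rightarrow> real" where
  "resp_prob p0 p1 p2 x = p1 - (p1 + p2 - 1) * (1 - p0) powr x"

definition eff :: "real \<Rightarrow> real \<Rightarrow> real \<Rightarrow> real \<Rightarrow> real" where
  "eff p0 p1 p2 x = inverse (resp_prob p0 p1 p2 x * (1 - resp_prob p0 p1 p2 x))"

text \<open>The gradient of \<^term>\<open>resp_prob p0 p1 p2 x\<close> in the parameter (p0, p1, p2).  The components
  1, 2, 3 of the vector belong to p0, p1, p2 in this order.\<close>

definition grad_resp :: "real \<Rightarrow> real \<Rightarrow> real \<Rightarrow> real \<Rightarrow> real ^ 3" where
  "grad_resp p0 p1 p2 x =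
     vector [x * (p1 + p2 - 1) * (1 - p0) powr (x - 1), 1 - (1 - p0) powr x, - ((1 - p0) powr x)]"

lemma grad_resp_is_gradient:
  assumes "p0 < 1"
  shows "((\<lambda>t. resp_prob t p1 p2 x) has_real_derivative grad_resp p0 p1 p2 x $ 1) (at p0)"
    and "((\<lambda>t. resp_prob p0 t p2 x) has_real_derivative grad_resp p0 p1 p2 x $ 2) (at p1)"
    and "((\<lambda>t. resp_prob p0 p1 t x) has_real_derivative grad_resp p0 p1 p2 x $ 3) (at p2)"
  using assms unfolding resp_prob_def grad_resp_def vector_3
  by (auto intro!: derivative_eq_intros)

text \<open>An approximate design is a finitely supported probability measure on the interval; its support
  points are \<^term>\<open>set_pmf \<xi>\<close> and its weights are the values \<^term>\<open>pmf \<xi> x\<close>, positive on the support.\<close>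

definition is_design :: "real \<Rightarrow> real \<Rightarrow> real pmf \<Rightarrow> bool" where
  "is_design xL xU \<xi> \<longleftrightarrow> finite (set_pmf \<xi>) \<and> set_pmf \<xi> \<subseteq> {xL..xU}"

definition info_matrix :: "real \<Rightarrow> real \<Rightarrow> real \<Rightarrow> real pmf \<Rightarrow> real ^ 3 ^ 3" where
  "info_matrix p0 p1 p2 \<xi> = (\<chi> i j. \<Sum>x\<in>set_pmf \<xi>.
     pmf \<xi> x * eff p0 p1 p2 x * grad_resp p0 p1 p2 x $ i * grad_resp p0 p1 p2 x $ j)"

definition p0_estimable :: "real \<Rightarrow> real \<Rightarrow> real \<Rightarrow> real pmf \<Rightarrow> bool" where
  "p0_estimable p0 p1 p2 \<xi> \<longleftrightarrow> axis 1 1 \<in> range (\<lambda>v. info_matrix p0 p1 p2 \<xi> *v v)"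

definition is_ginverse :: "real ^ 'm ^ 'n \<Rightarrow> real ^ 'n ^ 'm \<Rightarrow> bool" where
  "is_ginverse A G \<longleftrightarrow> A ** G ** A = A"

definition ginverse :: "real ^ 'm ^ 'n \<Rightarrow> real ^ 'n ^ 'm" where
  "ginverse A = (SOME G. is_ginverse A G)"

text \<open>The next two lemmas show that the arbitrary choice in \<^const>\<open>ginverse\<close> is harmless here: a
  generalized inverse always exists, and the (1,1) entry used below does not depend on which
  one is taken.\<close>

lemma is_ginverse_ginverse: "is_ginverse A (ginverse A)"
proof -
  obtain g where g: "linear g" "\<And>x. A *v (g (A *v x)) = A *v x"
  proof -
    obtain B where B: "B \<subseteq> range ((*v) A)" "independent B" "range ((*v) A) \<subseteq> span B"
      using basis_exists[of "range ((*v) A)"] by metis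
    have "\<forall>b\<in>B. \<exists>y. A *v y = b" using B(1) by auto
    then obtain h where h: "\<And>b. b \<in> B \<Longrightarrow> A *v h b = b" by metis
    obtain g where g: "linear g" "\<And>b. b \<in> B \<Longrightarrow> g b = h b"
      using linear_independent_extend[OF B(2), of h] by auto
    have lin: "linear (\<lambda>z. A *v g z)"
      using linear_compose[OF g(1) matrix_vector_mul_linear[of A]] by (simp add: o_def)
    have "A *v g z = z" if "z \<in> span B" for z
      using linear_eq_on[OF lin linear_ident that] g(2) h by simp
    then have "A *v (g (A *v x)) = A *v x" for x using B(3) by blast
    then show thesis using that g(1) by blast
  qed
  have "A ** matrix g ** A = A"
    using g by (simp add: matrix_eq matrix_works flip: matrix_vector_mul_assoc)
  then have "is_ginverse A (matrix g)" by (simp add: is_ginverse_def)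
  then show ?thesis unfolding ginverse_def by (rule someI)
qed

lemma ginverse_entry_unique:
  fixes A :: "real ^ 'n ^ 'n"
  assumes "transpose A = A" "axis i 1 \<in> range (\<lambda>v. A *v v)" "is_ginverse A G"
  shows "G $ i $ i = ginverse A $ i $ i"
proof -
  obtain v where v: "axis i 1 = A *v v" using assms(2) by auto
  have "H $ i $ i = v \<bullet> (A *v v)" if "is_ginverse A H" for H
  proof -
    have "H $ i $ i = axis i 1 \<bullet> (H *v axis i 1)"
      by (simp add: inner_axis' matrix_vector_mult_basis column_def)
    also have "\<dots> = (A *v v) \<bullet> (H *v (A *v v))" by (simp only: v)
    also have "\<dots> = v \<bullet> (A *v (H *v (A *v v)))"
      using assms(1) by (metis dot_lmul_matrix transpose_matrix_vector)
    also have "\<dots> = v \<bullet> (A *v v)"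
      using that by (simp add: is_ginverse_def matrix_vector_mul_assoc matrix_mul_assoc)
    finally show ?thesis .
  qed
  then show ?thesis using assms(3) is_ginverse_ginverse by metis
qed

definition Phi_s :: "real ^ 3 ^ 3 \<Rightarrow> real" where
  "Phi_s M = - ln (ginverse M $ 1 $ 1)"

definition Ds_optimal :: "real \<Rightarrow> real \<Rightarrow> real \<Rightarrow> real \<Rightarrow> real \<Rightarrow> real pmf \<Rightarrow> bool" where
  "Ds_optimal p0 p1 p2 xL xU \<xi> \<longleftrightarrow>
     is_design xL xU \<xi> \<and> p0_estimable p0 p1 p2 \<xi> \<and>
     (\<forall>\<eta>. is_design xL xU \<eta> \<and> p0_estimable p0 p1 p2 \<eta> \<longrightarrow>
        Phi_s (info_matrix p0 p1 p2 \<eta>) \<le> Phi_s (info_matrix p0 p1 p2 \<xi>))"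

definition c_const :: "real \<Rightarrow> real \<Rightarrow> real \<Rightarrow> real \<Rightarrow> real" where
  "c_const p0 p1 p2 xL = p1 / ((p1 + p2 - 1) * (1 - p0) powr xL)"

definition \<delta>_const :: "real \<Rightarrow> real" where
  "\<delta>_const p1 = (1 - p1) / p1"

definition r_const :: "real \<Rightarrow> real \<Rightarrow> real \<Rightarrow> real" where
  "r_const p0 xL xU = (1 - p0) powr (xU - xL)"

definition \<Delta>0 :: "real \<Rightarrow> real" where
  "\<Delta>0 r = r * ln r / (1 - r)"

definition \<Delta>1 :: "real \<Rightarrow> real \<Rightarrow> real \<Rightarrow> real \<Rightarrow> real" where
  "\<Delta>1 c \<delta> r a =
     ((a - r) * sqrt ((c - 1) * (\<delta> * c + 1)) + (1 - a) * sqrt ((c - r) * (\<delta> * c + r))) /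
     ((1 - r) * sqrt ((c - a) * (\<delta> * c + a)))"

definition \<Delta>2 :: "real \<Rightarrow> real \<Rightarrow> real \<Rightarrow> real \<Rightarrow> real" where
  "\<Delta>2 c \<delta> r a =
     (sqrt ((c - 1) * (\<delta> * c + 1)) - sqrt ((c - r) * (\<delta> * c + r))) /
     ((1 - r) * sqrt ((c - a) * (\<delta> * c + a)))"

definition Q1 :: "real \<Rightarrow> real \<Rightarrow> real \<Rightarrow> real \<Rightarrow> real \<Rightarrow> real \<Rightarrow> real" where
  "Q1 p0 p1 p2 x1 x2 x3 = inverse (eff p0 p1 p2 x1) * ((1 - p0) powr x2 - (1 - p0) powr x3)\<^sup>2"

definition Q2 :: "real \<Rightarrow> real \<Rightarrow> real \<Rightarrow> real \<Rightarrow> real \<Rightarrow> real \<Rightarrow> real" where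
  "Q2 p0 p1 p2 x1 x2 x3 = inverse (eff p0 p1 p2 x2) * ((1 - p0) powr x1 - (1 - p0) powr x3)\<^sup>2"

definition Q3 :: "real \<Rightarrow> real \<Rightarrow> real \<Rightarrow> real \<Rightarrow> real \<Rightarrow> real \<Rightarrow> real" where
  "Q3 p0 p1 p2 x1 x2 x3 = inverse (eff p0 p1 p2 x3) * ((1 - p0) powr x1 - (1 - p0) powr x2)\<^sup>2"

end

theory Submission
  imports Defs
begin

text \<open>
  For estimable \<open>p0\<close>, the reciprocal of \<open>(M\<^sup>-)\<^sub>1\<^sub>1\<close> is the minimum of \<open>u\<^sup>T M u\<close> over vectors
  \<open>u\<close> with first entry 1, so a design is optimal when it solves the maximin problem dual to the weighted
  Chebyshev approximation of the first gradient component by the other two.  In the variable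
  \<open>a = (1 - p0) powr (x - xL)\<close> this means approximating \<open>a ln a\<close> by affine functions on \<open>[r, 1]\<close>
  with weight \<open>1 / h\<close>, where \<open>h\<close> is the square root of the quadratic \<open>g a = (c - a) (\<delta> c + a)\<close>.
  The error is \<open>+\<epsilon> h\<close> at both ends and \<open>-\<epsilon> h\<close> at an interior point maximizing \<open>\<rho>\<close>, the gap between
  \<open>a ln a\<close> and its chord divided by the sum of \<open>h\<close> and its chord; the equation for \<open>A\<close> says that
  the derivative of \<open>\<rho>\<close> vanishes.

  Uniqueness: let \<open>\<psi>\<close> be the error for the level \<open>\<epsilon>\<close>.  A second critical point of \<open>\<rho>\<close> would give
  \<open>\<psi>\<^sup>2 - \<epsilon>\<^sup>2 g\<close> six zeros with multiplicity, hence its third derivative three zeros.  As \<open>g\<close> is quadratic, this third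
  derivative is a positive multiple of \<open>3 a \<psi>' - \<psi>\<close>, whose derivative \<open>2 ln a + const\<close>
  has at most one zero.
\<close>

section \<open>Weighted approximation of \<open>a ln a\<close> by affine functions\<close>

text \<open>At \<open>A\<close> the derivative crosses zero upwards, so the mean value theorem
  between \<open>A\<close> and a nearby point on either side yields a positive value.
  \<open>f\<close> cannot change sign there.\<close>

lemma same_sign_near_double_zero:
  fixes f f' :: "real \<Rightarrow> real"
  assumes der: "\<And>x. l < x \<Longrightarrow> x < u \<Longrightarrow> (f has_real_derivative f' x) (at x)"
    and A: "l < A" "A < u" "f A = 0" "f' A = 0"
    and d2: "(f' has_real_derivative D) (at A)" "D > 0"
  shows "(\<exists>z. l < z \<and> z < A \<and> f z > 0) \<and> (\<exists>z. A < z \<and> z < u \<and> f z > 0)"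
proof
  obtain e where e: "e > 0" "\<And>t. 0 < t \<Longrightarrow> t < e \<Longrightarrow> f' (A - t) < 0"
    using DERIV_pos_inc_left[OF d2] A(4) by auto
  obtain b where b: "max l (A - e) < b" "b < A"
    using A e(1) dense[of "max l (A - e)" A] by auto
  obtain z where z: "b < z" "z < A" "f A - f b = (A - b) * f' z"
    using MVT2[of b A f f'] der A b by force
  have "f' z < 0" using e(2)[of "A - z"] z b by auto
  then have "(A - b) * f' z < 0" using b by (intro mult_pos_neg) auto
  then show "\<exists>z. l < z \<and> z < A \<and> f z > 0" using z A b by (intro exI[of _ b]) auto
next
  obtain e where e: "e > 0" "\<And>t. 0 < t \<Longrightarrow> t < e \<Longrightarrow> f' (A + t) > 0"
    using DERIV_pos_inc_right[OF d2] A(4) by auto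
  obtain b where b: "A < b" "b < min u (A + e)"
    using A e(1) dense[of A "min u (A + e)"] by auto
  obtain z where z: "A < z" "z < b" "f b - f A = (b - A) * f' z"
    using MVT2[of A b f f'] der A b by force
  have "f' z > 0" using e(2)[of "z - A"] z b by auto
  then have "(b - A) * f' z > 0" using b by (intro mult_pos_pos) auto
  then show "\<exists>z. A < z \<and> z < u \<and> f z > 0" using z A b by (intro exI[of _ b]) auto
qed

lemma Rolle_zero:
  fixes f f' :: "real \<Rightarrow> real"
  assumes "a < b" "f a = 0" "f b = 0"
    and "\<And>x. a \<le> x \<Longrightarrow> x \<le> b \<Longrightarrow> (f has_real_derivative f' x) (at x)"
  obtains z where "a < z" "z < b" "f' z = 0"
  using MVT2[of a b f f'] assms by force

section \<open>The interpolation error of \<open>a ln a\<close> and its contact level\<close>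

locale weighted_chebyshev =
  fixes c d r :: real
  assumes c: "1 < c" and d: "0 \<le> d" and r: "0 < r" "r < 1"
begin

definition g :: "real \<Rightarrow> real" where "g a = (c - a) * (d + a)"

definition h :: "real \<Rightarrow> real" where "h a = sqrt (g a)"

definition slope :: real where "slope = (h 1 - h r) / (1 - r)"

definition chord :: "real \<Rightarrow> real" where
  "chord a = ((a - r) * h 1 + (1 - a) * h r) / (1 - r)"

text \<open>The chord of \<open>a ln a\<close> over \<open>[r, 1]\<close> minus
  \<open>a ln a\<close> itself; \<open>- \<Delta>0 r\<close> is the slope of that chord.\<close>

definition gap :: "real \<Rightarrow> real" where "gap a = \<Delta>0 r * (1 - a) - a * ln a"

text \<open>The level \<open>e\<close> at which \<open>\<psi> e\<close> meets \<open>- e * h\<close>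
  at \<open>a\<close>; that condition is linear in \<open>e\<close>.\<close>

definition \<rho> :: "real \<Rightarrow> real" where "\<rho> a = gap a / (chord a + h a)"

definition critical :: "real \<Rightarrow> bool" where
  "critical a \<longleftrightarrow> (- \<Delta>0 r - ln a - 1) * (chord a + h a)
     = gap a * (slope + (c - d - 2 * a) / (2 * h a))"

text \<open>This is \<open>a ln a\<close> plus the affine function for which the error equals
  \<open>e * h\<close> at both ends.\<close>

definition \<psi> :: "real \<Rightarrow> real \<Rightarrow> real" where "\<psi> e a = e * chord a - gap a"

definition d\<psi> :: "real \<Rightarrow> real \<Rightarrow> real" where "d\<psi> e a = e * slope + \<Delta>0 r + ln a + 1"

lemma g_pos: "r \<le> a \<Longrightarrow> a \<le> 1 \<Longrightarrow> g a > 0"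
  using c d r unfolding g_def by (intro mult_pos_pos) auto

lemma h_pos: "r \<le> a \<Longrightarrow> a \<le> 1 \<Longrightarrow> h a > 0"
  using g_pos unfolding h_def by simp

lemma h_square: "r \<le> a \<Longrightarrow> a \<le> 1 \<Longrightarrow> (h a)\<^sup>2 = g a"
  using g_pos[of a] unfolding h_def by simp

lemma chord_ends: "chord r = h r" "chord 1 = h 1"
  using r by (auto simp: chord_def)

lemma chord_affine: "chord a = h 1 - slope * (1 - a)"
  using r unfolding chord_def slope_def by (simp add: divide_simps) (simp add: algebra_simps)

lemma chord_pos: "r \<le> a \<Longrightarrow> a \<le> 1 \<Longrightarrow> chord a > 0"
proof -
  assume a: "r \<le> a" "a \<le> 1"
  have "(a - r) * h 1 + (1 - a) * h r > 0"
  proof (cases "a = 1")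
    case False
    then show ?thesis
      using a r h_pos[of 1] h_pos[of r] by (intro add_nonneg_pos mult_nonneg_nonneg mult_pos_pos) auto
  qed (use r h_pos[of 1] in auto)
  then show ?thesis using r unfolding chord_def by simp
qed

text \<open>\<^term>\<open>h\<close> is the geometric mean of two affine functions, so it is concave by Cauchy-Schwarz.\<close>

lemma chord_le_h:
  assumes a: "r \<le> a" "a \<le> 1"
  shows "chord a \<le> h a"
proof -
  define s where "s = (a - r) / (1 - r)"
  have s: "0 \<le> s" "s \<le> 1" using a r by (auto simp: s_def)
  have s1: "1 - s = (1 - a) / (1 - r)" using r by (simp add: s_def field_simps)
  have "s * (1 - r) = a - r" using r by (simp add: s_def)
  then have a_eq: "a = s + (1 - s) * r" by (simp add: algebra_simps)
  have ch: "chord a = s * h 1 + (1 - s) * h r"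
    unfolding chord_def s1 by (simp add: s_def add_divide_distrib)
  have hh: "h 1 = sqrt (c - 1) * sqrt (d + 1)" "h r = sqrt (c - r) * sqrt (d + r)"
    by (simp_all add: h_def g_def real_sqrt_mult)
  define P0 P1 R0 R1 where "P0 = sqrt (c - r)" and "P1 = sqrt (c - 1)"
    and "R0 = sqrt (d + r)" and "R1 = sqrt (d + 1)"
  have sq: "P0\<^sup>2 = c - r" "P1\<^sup>2 = c - 1" "R0\<^sup>2 = d + r" "R1\<^sup>2 = d + 1"
    using c d r by (auto simp: P0_def P1_def R0_def R1_def)
  have "g a = (s * P1\<^sup>2 + (1 - s) * P0\<^sup>2) * (s * R1\<^sup>2 + (1 - s) * R0\<^sup>2)"
    unfolding g_def sq a_eq by (simp add: algebra_simps)
  \<comment> \<open>Lagrange's identity; the last summand is nonnegative because \<open>s\<close>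
    lies between 0 and 1.\<close>
  also have "\<dots> = (s * (P1 * R1) + (1 - s) * (P0 * R0))\<^sup>2 + s * (1 - s) * (P1 * R0 - P0 * R1)\<^sup>2"
    by (simp add: power2_eq_square algebra_simps)
  finally have "(chord a)\<^sup>2 \<le> g a"
    using s by (simp add: ch hh P0_def P1_def R0_def R1_def)
  then show ?thesis unfolding h_def by (rule real_le_rsqrt)
qed

lemma gap_ends: "gap r = 0" "gap 1 = 0"
  using r by (auto simp: gap_def \<Delta>0_def)

lemma gap_deriv: "0 < a \<Longrightarrow> (gap has_real_derivative - \<Delta>0 r - ln a - 1) (at a)"
  unfolding gap_def by (auto intro!: derivative_eq_intros)

text \<open>Strict convexity of \<open>a ln a\<close>: the derivative of \<open>gap\<close> strictly
  decreases, but a nonpositive value between the two end zeros would make it nonpositive first and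
  nonnegative later.\<close>

lemma gap_pos:
  assumes a: "r < a" "a < 1"
  shows "gap a > 0"
proof (rule ccontr)
  assume "\<not> gap a > 0"
  then have le: "gap a \<le> 0" by simp
  obtain y where y: "r < y" "y < a" "gap a - gap r = (a - r) * (- \<Delta>0 r - ln y - 1)"
    using MVT2[of r a gap "\<lambda>a. - \<Delta>0 r - ln a - 1"] gap_deriv a r by force
  obtain z where z: "a < z" "z < 1" "gap 1 - gap a = (1 - a) * (- \<Delta>0 r - ln z - 1)"
    using MVT2[of a 1 gap "\<lambda>a. - \<Delta>0 r - ln a - 1"] gap_deriv a r by force
  have "(a - r) * (- \<Delta>0 r - ln y - 1) \<le> 0" using y(3) le gap_ends by linarith
  then have "- \<Delta>0 r - ln y - 1 \<le> 0" using a by (simp add: mult_le_0_iff)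
  moreover have "0 \<le> (1 - a) * (- \<Delta>0 r - ln z - 1)" using z(3) le gap_ends by linarith
  then have "0 \<le> - \<Delta>0 r - ln z - 1" using a by (simp add: zero_le_mult_iff)
  moreover have "ln y < ln z" using y z r by simp
  ultimately show False by simp
qed

lemma denominator_pos: "r \<le> a \<Longrightarrow> a \<le> 1 \<Longrightarrow> chord a + h a > 0"
  using chord_pos h_pos by (simp add: add_pos_pos)

lemma \<rho>_ends: "\<rho> r = 0" "\<rho> 1 = 0"
  by (simp_all add: \<rho>_def gap_ends)

lemma \<rho>_pos: "r < a \<Longrightarrow> a < 1 \<Longrightarrow> \<rho> a > 0"
  using gap_pos[of a] denominator_pos[of a] by (simp add: \<rho>_def)

lemma \<rho>_nonneg: "r \<le> a \<Longrightarrow> a \<le> 1 \<Longrightarrow> \<rho> a \<ge> 0"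
  using \<rho>_pos[of a] \<rho>_ends by (cases "a = r"; cases "a = 1") auto

lemma g_deriv: "(g has_real_derivative c - d - 2 * a) (at a)"
  unfolding g_def by (auto intro!: derivative_eq_intros simp: algebra_simps)

lemma h_deriv:
  assumes "r \<le> a" "a \<le> 1"
  shows "(h has_real_derivative (c - d - 2 * a) / (2 * h a)) (at a)"
  using DERIV_chain2[OF DERIV_real_sqrt[OF g_pos[OF assms]] g_deriv]
  unfolding h_def by (simp add: field_simps)

lemma chord_deriv: "(chord has_real_derivative slope) (at a)"
  unfolding chord_affine[abs_def] by (auto intro!: derivative_eq_intros)

lemma \<rho>_deriv:
  assumes "r \<le> a" "a \<le> 1"
  shows "(\<rho> has_real_derivative ((- \<Delta>0 r - ln a - 1) * (chord a + h a)
     - gap a * (slope + (c - d - 2 * a) / (2 * h a))) / ((chord a + h a) * (chord a + h a))) (at a)"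
  unfolding \<rho>_def
  using assms r denominator_pos[of a]
  by (intro DERIV_divide gap_deriv DERIV_add chord_deriv h_deriv) auto

lemma continuous_on_\<rho>: "continuous_on {r..1} \<rho>"
  by (meson DERIV_isCont \<rho>_deriv atLeastAtMost_iff continuous_at_imp_continuous_on)

lemma maximizer_critical:
  assumes a: "r < a" "a < 1" and max: "\<forall>y\<in>{r..1}. \<rho> y \<le> \<rho> a"
  shows "critical a"
proof -
  have "0 < min (a - r) (1 - a)" using a by simp
  moreover have "\<forall>y. \<bar>a - y\<bar> < min (a - r) (1 - a) \<longrightarrow> \<rho> y \<le> \<rho> a"
    using max by (auto simp: abs_if split: if_splits)
  ultimately have "((- \<Delta>0 r - ln a - 1) * (chord a + h a)
     - gap a * (slope + (c - d - 2 * a) / (2 * h a))) / ((chord a + h a) * (chord a + h a)) = 0"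
    using DERIV_local_max[OF \<rho>_deriv] a by (metis less_imp_le)
  then show ?thesis using denominator_pos[of a] a by (auto simp: critical_def)
qed

lemma maximizer_exists:
  obtains m where "r < m" "m < 1" "\<forall>y\<in>{r..1}. \<rho> y \<le> \<rho> m"
proof -
  obtain m where m: "m \<in> {r..1}" "\<And>y. y \<in> {r..1} \<Longrightarrow> \<rho> y \<le> \<rho> m"
    using continuous_attains_sup[OF _ _ continuous_on_\<rho>] r by force
  obtain b where b: "r < b" "b < 1" using dense r by blast
  have "\<rho> m > 0" using m(2)[of b] \<rho>_pos[OF b] b by auto
  then have "m \<noteq> r" "m \<noteq> 1" using \<rho>_ends by auto
  then show thesis using that[of m] m by auto
qed

section \<open>Zero counts for \<open>F\<close> and its derivatives\<close>

definition F :: "real \<Rightarrow> real \<Rightarrow> real" where "F e a = (\<psi> e a)\<^sup>2 - e\<^sup>2 * g a"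

definition F1 :: "real \<Rightarrow> real \<Rightarrow> real" where
  "F1 e a = 2 * \<psi> e a * d\<psi> e a - e\<^sup>2 * (c - d - 2 * a)"

definition F2 :: "real \<Rightarrow> real \<Rightarrow> real" where
  "F2 e a = 2 * (d\<psi> e a)\<^sup>2 + 2 * \<psi> e a / a + 2 * e\<^sup>2"

definition F3 :: "real \<Rightarrow> real \<Rightarrow> real" where
  "F3 e a = 2 * (3 * a * d\<psi> e a - \<psi> e a) / a\<^sup>2"

lemma d\<psi>_deriv: "0 < a \<Longrightarrow> (d\<psi> e has_real_derivative 1 / a) (at a)"
  unfolding d\<psi>_def by (auto intro!: derivative_eq_intros)

lemma \<psi>_deriv: "0 < a \<Longrightarrow> (\<psi> e has_real_derivative d\<psi> e a) (at a)"
  unfolding \<psi>_def d\<psi>_def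
  by (rule derivative_eq_intros chord_deriv gap_deriv refl | assumption)+ simp

lemma F_deriv: "0 < a \<Longrightarrow> (F e has_real_derivative F1 e a) (at a)"
  unfolding F_def F1_def
  by (rule derivative_eq_intros \<psi>_deriv g_deriv refl | assumption)+ simp

lemma F1_deriv: "0 < a \<Longrightarrow> (F1 e has_real_derivative F2 e a) (at a)"
  unfolding F1_def F2_def
  by (rule derivative_eq_intros \<psi>_deriv d\<psi>_deriv refl | assumption)+
     (simp add: field_simps power2_eq_square)

lemma F2_deriv: "0 < a \<Longrightarrow> (F2 e has_real_derivative F3 e a) (at a)"
  unfolding F2_def F3_def
  by (auto intro!: derivative_eq_intros \<psi>_deriv d\<psi>_deriv)
     (simp add: field_simps power2_eq_square)

text \<open>Three zeros of the factor \<open>w\<close> would give two of its derivative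
  \<open>2 * d\<psi> e a + 3\<close>, which is strictly increasing like the logarithm in it.\<close>

lemma F3_zeros:
  assumes "0 < x" "x < y" "y < z" "F3 e x = 0" "F3 e y = 0" "F3 e z = 0"
  shows False
proof -
  define w where "w a = 3 * a * d\<psi> e a - \<psi> e a" for a
  have w: "w x = 0" "w y = 0" "w z = 0" using assms by (auto simp: F3_def w_def)
  have der: "(w has_real_derivative 2 * d\<psi> e a + 3) (at a)" if "0 < a" for a
    using that unfolding w_def
    by (auto intro!: derivative_eq_intros \<psi>_deriv d\<psi>_deriv simp: field_simps)
  obtain s where s: "x < s" "s < y" "2 * d\<psi> e s + 3 = 0"
    using Rolle_zero[of x y w "\<lambda>a. 2 * d\<psi> e a + 3"] der w assms by auto
  obtain t where t: "y < t" "t < z" "2 * d\<psi> e t + 3 = 0"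
    using Rolle_zero[of y z w "\<lambda>a. 2 * d\<psi> e a + 3"] der w assms by auto
  have "ln s < ln t" using s t assms by simp
  then show False using s t by (simp add: d\<psi>_def)
qed

lemma F2_zeros:
  assumes "0 < w" "w < x" "x < y" "y < z" "F2 e w = 0" "F2 e x = 0" "F2 e y = 0" "F2 e z = 0"
  shows False
proof -
  obtain s where "w < s" "s < x" "F3 e s = 0"
    using Rolle_zero[of w x "F2 e" "F3 e"] F2_deriv assms by auto
  moreover obtain t where "x < t" "t < y" "F3 e t = 0"
    using Rolle_zero[of x y "F2 e" "F3 e"] F2_deriv assms by auto
  moreover obtain u where "y < u" "u < z" "F3 e u = 0"
    using Rolle_zero[of y z "F2 e" "F3 e"] F2_deriv assms by auto
  ultimately show False using F3_zeros[of s t u e] assms by simp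
qed

text \<open>Rolle leaves four zeros of \<open>F2\<close>. Through this bound zeros of
  \<open>F\<close> are counted with multiplicity: Rolle points between them, plus the double zeros
  themselves.\<close>

lemma F1_zeros:
  assumes "0 < v" "v < w" "w < x" "x < y" "y < z"
    "F1 e v = 0" "F1 e w = 0" "F1 e x = 0" "F1 e y = 0" "F1 e z = 0"
  shows False
proof -
  obtain s where "v < s" "s < w" "F2 e s = 0"
    using Rolle_zero[of v w "F1 e" "F2 e"] F1_deriv assms by auto
  moreover obtain t where "w < t" "t < x" "F2 e t = 0"
    using Rolle_zero[of w x "F1 e" "F2 e"] F1_deriv assms by auto
  moreover obtain u where "x < u" "u < y" "F2 e u = 0"
    using Rolle_zero[of x y "F1 e" "F2 e"] F1_deriv assms by auto
  moreover obtain q where "y < q" "q < z" "F2 e q = 0"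
    using Rolle_zero[of y z "F1 e" "F2 e"] F1_deriv assms by auto
  ultimately show False using F2_zeros[of s t u q e] assms by simp
qed

lemma F1_between:
  assumes "0 < x" "x < y" "F e x = 0" "F e y = 0"
  obtains z where "x < z" "z < y" "F1 e z = 0"
  using Rolle_zero[of x y "F e" "F1 e"] F_deriv assms by auto

lemma F_ends: "F e r = 0" "F e 1 = 0"
  using h_square[of r] h_square[of 1] r
  by (simp_all add: F_def \<psi>_def chord_ends gap_ends power_mult_distrib)

lemma \<psi>_plus: "r \<le> a \<Longrightarrow> a \<le> 1 \<Longrightarrow> \<psi> e a + e * h a = (chord a + h a) * (e - \<rho> a)"
  using denominator_pos[of a] by (simp add: \<psi>_def \<rho>_def field_simps)

lemma \<psi>_ends: "\<psi> e 1 = e * h 1" "\<psi> e r = e * h r"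
  by (simp_all add: \<psi>_def chord_ends gap_ends)

lemma \<psi>_touch: "r \<le> a \<Longrightarrow> a \<le> 1 \<Longrightarrow> \<psi> (\<rho> a) a = - \<rho> a * h a"
  using \<psi>_plus[of a "\<rho> a"] by simp

lemma \<psi>_less:
  assumes "0 \<le> e" "r < a" "a < 1"
  shows "\<psi> e a < e * h a"
  using mult_left_mono[OF chord_le_h[of a] assms(1)] gap_pos[of a] assms by (simp add: \<psi>_def)

text \<open>A difference of squares whose factor \<open>\<psi> e a + e * h a\<close> vanishes at the
  level \<open>\<rho> a\<close>. As the other factors are positive inside for
  \<open>0 \<le> e\<close>, the sign of \<open>F\<close> compares \<open>\<rho>\<close> with
  \<open>e\<close>.\<close>

lemma F_factor:
  assumes "r \<le> a" "a \<le> 1"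
  shows "F e a = (e * h a - \<psi> e a) * (chord a + h a) * (\<rho> a - e)"
proof -
  have "F e a = (\<psi> e a - e * h a) * (\<psi> e a + e * h a)"
    unfolding F_def h_square[OF assms, symmetric] by (simp add: power2_eq_square algebra_simps)
  then show ?thesis unfolding \<psi>_plus[OF assms] by (simp add: algebra_simps)
qed

lemma F_sgn:
  assumes "0 \<le> e" "r < a" "a < 1"
  shows "sgn (F e a) = sgn (\<rho> a - e)"
  using F_factor[of a e] \<psi>_less[of e a] denominator_pos[of a] assms
  by (simp add: sgn_mult)

lemma F_eq_0:
  assumes "0 \<le> e" "r < a" "a < 1" "\<rho> a = e"
  shows "F e a = 0"
  using F_sgn[OF assms(1-3)] assms(4) by (simp add: sgn_if split: if_splits)

text \<open>Criticality says that \<open>\<psi> e\<close> and \<open>- e * h\<close> have equal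
  derivatives where they meet, so the contact is a double zero of \<open>F e\<close>.\<close>

lemma F1_critical:
  assumes a: "r < a" "a < 1" and "critical a"
  shows "F1 (\<rho> a) a = 0"
proof -
  define e where "e = \<rho> a"
  have h: "h a > 0" and den: "chord a + h a > 0" using h_pos denominator_pos a by auto
  have gap: "gap a = e * (chord a + h a)" using den by (simp add: e_def \<rho>_def)
  define X where "X = (c - d - 2 * a) / (2 * h a)"
  have "(- \<Delta>0 r - ln a - 1) * (chord a + h a) = e * (slope + X) * (chord a + h a)"
    using assms(3) gap by (simp add: critical_def X_def)
  then have "- \<Delta>0 r - ln a - 1 = e * (slope + X)" using den by simp
  then have "d\<psi> e a = - e * X" by (simp add: d\<psi>_def algebra_simps)
  moreover have "\<psi> e a = - e * h a" by (simp add: \<psi>_def gap algebra_simps)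
  ultimately show ?thesis
    using h by (simp add: F1_def X_def e_def[symmetric] power2_eq_square)
qed

section \<open>Uniqueness of the critical point\<close>

lemma \<rho>_IVT:
  assumes "r \<le> x" "x < y" "y \<le> 1" "\<rho> x < e \<and> e < \<rho> y \<or> \<rho> y < e \<and> e < \<rho> x"
  obtains z where "x < z" "z < y" "\<rho> z = e"
proof -
  have cont: "continuous_on {x..y} \<rho>"
    by (rule continuous_on_subset[OF continuous_on_\<rho>]) (use assms in auto)
  have "\<exists>z. x \<le> z \<and> z \<le> y \<and> \<rho> z = e"
    using assms IVT'[OF _ _ _ cont, of e] IVT2'[OF _ _ _ cont, of e] by force
  then obtain z where "x \<le> z" "z \<le> y" "\<rho> z = e" by blast
  moreover then have "z \<noteq> x" "z \<noteq> y" using assms(4) by auto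
  ultimately show thesis using that[of z] by auto
qed

text \<open>The zeros \<open>r, x, y, z, 1\<close> of \<open>F e\<close> give four Rolle points for
  \<open>F1 e\<close>; the double zero is a fifth.\<close>

lemma no_double_and_two:
  assumes e: "0 \<le> e" and ord: "r < x" "x < y" "y < z" "z < 1"
    and "\<rho> x = e" "\<rho> y = e" "\<rho> z = e"
    and "F1 e x = 0 \<or> F1 e y = 0 \<or> F1 e z = 0"
  shows False
proof -
  have 0: "F e x = 0" "F e y = 0" "F e z = 0" using F_eq_0 e assms by auto
  obtain p where p: "r < p" "p < x" "F1 e p = 0"
    using F1_between[of r x e] F_ends 0 ord r by auto
  obtain q where q: "x < q" "q < y" "F1 e q = 0"
    using F1_between[of x y e] 0 ord r by auto
  obtain s where s: "y < s" "s < z" "F1 e s = 0"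
    using F1_between[of y z e] 0 ord r by auto
  obtain t where t: "z < t" "t < 1" "F1 e t = 0"
    using F1_between[of z 1 e] F_ends 0 ord r by auto
  show False using F1_zeros[of p x q s t e] F1_zeros[of p q y s t e] F1_zeros[of p q s z t e]
      p q s t r assms(9) by auto
qed

text \<open>The zeros \<open>r, x, y, 1\<close> of \<open>F e\<close> give three Rolle points; the
  two double zeros make five.\<close>

lemma no_two_doubles:
  assumes e: "0 \<le> e" and ord: "r < x" "x < y" "y < 1"
    and "\<rho> x = e" "\<rho> y = e" "F1 e x = 0" "F1 e y = 0"
  shows False
proof -
  have 0: "F e x = 0" "F e y = 0" using F_eq_0 e assms by auto
  obtain p where p: "r < p" "p < x" "F1 e p = 0"
    using F1_between[of r x e] F_ends 0 ord r by auto
  obtain q where q: "x < q" "q < y" "F1 e q = 0"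
    using F1_between[of x y e] 0 ord r by auto
  obtain t where t: "y < t" "t < 1" "F1 e t = 0"
    using F1_between[of y 1 e] F_ends 0 ord r by auto
  show False using F1_zeros[of p x q y t e] p q t r assms by auto
qed

text \<open>\<open>F1 e\<close> vanishes at \<open>x\<close> and at three Rolle points. These four
  zeros give three of \<open>F2 e\<close> apart from \<open>x\<close>, and \<open>x\<close> itself
  is a fourth.\<close>

lemma no_triple_and_one:
  assumes e: "0 \<le> e" and ord: "r < x" "x < 1" "r < y" "y < 1" "x \<noteq> y"
    and "\<rho> x = e" "\<rho> y = e" "F1 e x = 0" "F2 e x = 0"
  shows False
proof -
  have "F e x = 0" "F e y = 0" using F_eq_0 e assms by auto
  then have 0: "F e (min x y) = 0" "F e (max x y) = 0" by (simp_all add: min_def max_def)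
  have mm: "r < min x y" "min x y < max x y" "max x y < 1" using ord by auto
  obtain p where p: "r < p" "p < min x y" "F1 e p = 0"
    using F1_between[OF r(1) mm(1) F_ends(1) 0(1)] by blast
  obtain q where q: "min x y < q" "q < max x y" "F1 e q = 0"
    using F1_between[OF _ mm(2) 0] r mm by force
  obtain t where t: "max x y < t" "t < 1" "F1 e t = 0"
    using F1_between[OF _ mm(3) 0(2) F_ends(2)] r mm by force
  have F2: "\<exists>s. u < s \<and> s < v \<and> F2 e s = 0" if uv: "0 < u" "u < v" "F1 e u = 0" "F1 e v = 0" for u v
  proof -
    obtain s where "u < s" "s < v" "F2 e s = 0"
      using Rolle_zero[of u v "F1 e" "F2 e"] F1_deriv uv by auto
    then show ?thesis by blast
  qed
  show False
  proof (cases "x < y")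
    case True
    obtain a where "p < a" "a < x" "F2 e a = 0" using F2[of p x] p r True assms by auto
    moreover obtain b where "x < b" "b < q" "F2 e b = 0" using F2[of x q] q r True assms by auto
    moreover obtain w where "q < w" "w < t" "F2 e w = 0" using F2[of q t] q t r True assms by auto
    ultimately show False using F2_zeros[of a x b w e] assms p r by auto
  next
    case False
    obtain a where "p < a" "a < q" "F2 e a = 0" using F2[of p q] p q r False assms by auto
    moreover obtain b where "q < b" "b < x" "F2 e b = 0" using F2[of q x] q r False assms by auto
    moreover obtain w where "x < w" "w < t" "F2 e w = 0" using F2[of x t] t r False assms by auto
    ultimately show False using F2_zeros[of a b x w e] assms p r by auto
  qed
qed

text \<open>Were \<open>F2 e x\<close> nonzero, \<open>F e\<close> would take its sign on both sides
  of the double zero \<open>x\<close>, against the sign change of \<open>\<rho> - e\<close>.\<close>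

lemma sign_change_triple:
  assumes e: "0 \<le> e" and ord: "r \<le> l" "l < x" "x < u" "u \<le> 1"
    and "\<rho> x = e" "F1 e x = 0"
    and sgn: "(\<forall>z. l < z \<longrightarrow> z < x \<longrightarrow> \<rho> z < e) \<and> (\<forall>z. x < z \<longrightarrow> z < u \<longrightarrow> \<rho> z > e) \<or>
       (\<forall>z. l < z \<longrightarrow> z < x \<longrightarrow> \<rho> z > e) \<and> (\<forall>z. x < z \<longrightarrow> z < u \<longrightarrow> \<rho> z < e)"
  shows "F2 e x = 0"
proof (rule ccontr)
  assume ne: "F2 e x \<noteq> 0"
  have 0: "F e x = 0" using F_eq_0 e assms by auto
  have der: "(F e has_real_derivative F1 e z) (at z)" if "l < z" "z < u" for z
    using F_deriv that ord r by auto
  have der': "((\<lambda>z. - F e z) has_real_derivative - F1 e z) (at z)" if "l < z" "z < u" for z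
    using der[OF that] by (rule DERIV_minus)
  have s: "F e z > 0 \<longleftrightarrow> \<rho> z > e" "F e z < 0 \<longleftrightarrow> \<rho> z < e" if "l < z" "z < u" for z
    using F_sgn[of e z] e that ord by (auto simp: sgn_if split: if_splits)
  have x: "0 < x" using ord r by simp
  show False
  proof (cases "F2 e x > 0")
    case True
    obtain y z where "l < y" "y < x" "F e y > 0" "x < z" "z < u" "F e z > 0"
      using same_sign_near_double_zero[OF der ord(2,3) 0 assms(7) F1_deriv[OF x] True] by blast
    moreover from this have "\<rho> y > e" "\<rho> z > e" using s ord by auto
    ultimately show False using sgn by force
  next
    case False
    then have neg: "- F2 e x > 0" using ne by simp
    obtain y z where "l < y" "y < x" "- F e y > 0" "x < z" "z < u" "- F e z > 0"
      using same_sign_near_double_zero[OF der' ord(2,3) _ _ DERIV_minus[OF F1_deriv[OF x]] neg]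
        0 assms(7) by (metis neg_equal_0_iff_equal)
    moreover from this have "\<rho> y < e" "\<rho> z < e" using s ord by auto
    ultimately show False using sgn by force
  qed
qed

text \<open>If \<open>a\<close> is lower than \<open>m\<close>, its level recurs at some
  \<open>b\<close> beyond \<open>m\<close>. Zero counting then makes \<open>a\<close> the only point
  of that level on its side of \<open>m\<close>, so \<open>\<rho> - e\<close> changes sign at
  \<open>a\<close> and a triple zero results. Equal heights give two double zeros.\<close>

lemma critical_unique:
  assumes a: "r < a" "a < 1" and crit: "critical a"
    and m: "r < m" "m < 1" and max: "\<forall>y\<in>{r..1}. \<rho> y \<le> \<rho> m"
  shows "a = m"
proof (rule ccontr)
  assume ne: "a \<noteq> m"
  define e where "e = \<rho> a"
  have ra: "\<rho> a = e" by (simp add: e_def)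
  have e: "0 < e" using \<rho>_pos a by (simp add: e_def)
  then have e0: "0 \<le> e" by simp
  have Fa: "F1 e a = 0" using F1_critical[OF a crit] by (simp add: e_def)
  have Fm: "F1 (\<rho> m) m = 0" using F1_critical[OF m] maximizer_critical[OF m max] by simp
  show False
  proof (cases "\<rho> m = e")
    case True
    then have Fm: "F1 e m = 0" using Fm by simp
    show False
      using no_two_doubles[OF e0 a(1) _ m(2) ra True Fa Fm]
        no_two_doubles[OF e0 m(1) _ a(2) True ra Fm Fa] ne by linarith
  next
    case False
    then have less: "e < \<rho> m" using bspec[OF max, of a] a ra by simp
    show False
    proof (cases "a < m")
      case True
      \<comment> \<open>\<open>\<rho>\<close> falls from above \<open>e\<close> at \<open>m\<close>
        to \<open>0\<close> at the right end.\<close>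
      obtain b where b: "m < b" "b < 1" "\<rho> b = e"
        using \<rho>_IVT[of m 1 e] m less e \<rho>_ends by auto
      have noz: "\<rho> z \<noteq> e" if "r < z" "z < m" "z \<noteq> a" for z
        using no_double_and_two[OF e0, of z a b] no_double_and_two[OF e0, of a z b]
          that a b ra Fa True by (cases "z < a") auto
      \<comment> \<open>A higher value would force a crossing of \<open>e\<close> on the way up from
        \<open>\<rho> r = 0\<close>.\<close>
      have "\<rho> z < e" if z: "r < z" "z < a" for z
      proof (rule ccontr)
        assume "\<not> \<rho> z < e"
        then have "\<rho> z > e" using noz[of z] z True by force
        then obtain y where "r < y" "y < z" "\<rho> y = e" using \<rho>_IVT[of r z e] z a e \<rho>_ends by auto
        then show False using noz[of y] z True by auto
      qed
      moreover have "\<rho> z > e" if z: "a < z" "z < m" for z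
      proof (rule ccontr)
        assume "\<not> \<rho> z > e"
        then have "\<rho> z < e" using noz[of z] z a by force
        then obtain y where "z < y" "y < m" "\<rho> y = e" using \<rho>_IVT[of z m e] z a m less by auto
        then show False using noz[of y] z a by auto
      qed
      ultimately have "F2 e a = 0"
        using sign_change_triple[OF e0, of r a m] a m True Fa ra by auto
      then show False
        using no_triple_and_one[OF e0, of a b] a b m True Fa ra by auto
    next
      case False
      with ne have True: "m < a" by simp
      \<comment> \<open>Mirror image: the level of \<open>a\<close> now recurs to the left of
        \<open>m\<close>.\<close>
      obtain b where b: "r < b" "b < m" "\<rho> b = e"
        using \<rho>_IVT[of r m e] m less e \<rho>_ends by auto
      have noz: "\<rho> z \<noteq> e" if "m < z" "z < 1" "z \<noteq> a" for z
        using no_double_and_two[OF e0, of b z a] no_double_and_two[OF e0, of b a z]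
          that a b ra Fa True m by (cases "z < a") auto
      have "\<rho> z < e" if z: "a < z" "z < 1" for z
      proof (rule ccontr)
        assume "\<not> \<rho> z < e"
        then have "\<rho> z > e" using noz[of z] z True by force
        then obtain y where "z < y" "y < 1" "\<rho> y = e" using \<rho>_IVT[of z 1 e] z a e \<rho>_ends by auto
        then show False using noz[of y] z True by auto
      qed
      moreover have "\<rho> z > e" if z: "m < z" "z < a" for z
      proof (rule ccontr)
        assume "\<not> \<rho> z > e"
        then have "\<rho> z < e" using noz[of z] z a by force
        then obtain y where "m < y" "y < z" "\<rho> y = e" using \<rho>_IVT[of m z e] z a m less by auto
        then show False using noz[of y] z a by auto
      qed
      ultimately have "F2 e a = 0"
        using sign_change_triple[OF e0, of m a 1] a m True Fa ra by auto
      then show False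
        using no_triple_and_one[OF e0, of a b] a b m True Fa ra by auto
    qed
  qed
qed

text \<open>A further interior zero would also be a global maximizer of \<open>\<rho>\<close>, hence
  critical, hence \<open>m\<close>. This later confines the support of an optimal design to three
  points.\<close>

lemma F_maximizer:
  assumes m: "r < m" "m < 1" and max: "\<forall>y\<in>{r..1}. \<rho> y \<le> \<rho> m"
    and a: "r \<le> a" "a \<le> 1"
  shows "F (\<rho> m) a \<le> 0" "F (\<rho> m) a = 0 \<Longrightarrow> a \<in> {r, m, 1}"
proof -
  have e: "0 \<le> \<rho> m" using \<rho>_nonneg m by simp
  show "F (\<rho> m) a \<le> 0"
    using F_ends F_sgn[OF e, of a] bspec[OF max, of a] a
    by (cases "a = r \<or> a = 1") (auto simp: sgn_if split: if_splits)
  assume 0: "F (\<rho> m) a = 0"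
  show "a \<in> {r, m, 1}"
  proof (cases "a = r \<or> a = 1")
    case False
    then have a': "r < a" "a < 1" using a by auto
    then have "\<rho> a = \<rho> m" using F_sgn[OF e, of a] 0 by (simp add: sgn_if split: if_splits)
    then have "critical a" using maximizer_critical[OF a'] max by simp
    then show ?thesis using critical_unique[OF a' _ m max] by blast
  qed auto
qed

text \<open>With \<open>\<Delta>1 = chord / h\<close> and \<open>\<Delta>2 = slope / h\<close>, both
  sides acquire the denominator \<open>gap a * h a\<close>, and the numerators are twice the two
  sides of \<open>critical\<close>.\<close>

lemma critical_iff:
  assumes a: "r < a" "a < 1" and d_eq: "d = \<delta> * c"
  shows "2 * (1 + \<Delta>1 c \<delta> r a) / a *
        (1 + (1 + \<Delta>0 r * (1 / a)) / (ln a - \<Delta>0 r * (1 / a - 1)))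
      = 1 / (\<delta> * c + a) - 1 / (c - a) + 2 * \<Delta>2 c \<delta> r a \<longleftrightarrow> critical a"
proof -
  define N where "N = - \<Delta>0 r - ln a - 1"
  define X where "X = slope + (c - d - 2 * a) / (2 * h a)"
  have pos: "h a > 0" "g a > 0" "gap a > 0" "a > 0" "c - a > 0" "d + a > 0"
    using h_pos g_pos gap_pos a r c d by auto
  have \<Delta>1: "\<Delta>1 c \<delta> r a = chord a / h a"
    unfolding \<Delta>1_def d_eq[symmetric] chord_def h_def g_def by simp
  have \<Delta>2: "\<Delta>2 c \<delta> r a = slope / h a"
    unfolding \<Delta>2_def d_eq[symmetric] slope_def h_def g_def by simp
  have den: "ln a - \<Delta>0 r * (1 / a - 1) = - gap a / a"
    using pos by (simp add: gap_def field_simps)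
  have num: "1 + (1 + \<Delta>0 r * (1 / a)) / (- gap a / a) = N * a / gap a"
    using pos by (simp add: N_def field_simps) (simp add: gap_def algebra_simps)
  have l: "2 * (1 + chord a / h a) / a * (N * a / gap a) = 2 * ((chord a + h a) * N) / (gap a * h a)"
    using pos by (simp add: field_simps)
  define Y where "Y = c - d - 2 * a"
  \<comment> \<open>The logarithmic derivative of \<open>g\<close>.\<close>
  have "1 / (d + a) - 1 / (c - a) = Y / g a"
    using pos by (simp add: g_def Y_def field_simps)
  also have "g a = h a * h a" using h_square[of a] a by (simp add: power2_eq_square)
  finally have "1 / (d + a) - 1 / (c - a) + 2 * (slope / h a) = 2 * X / h a"
    by (simp add: X_def Y_def[symmetric] add_divide_distrib)
  also have "\<dots> = 2 * (gap a * X) / (gap a * h a)" using pos by simp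
  finally have rr: "1 / (d + a) - 1 / (c - a) + 2 * (slope / h a) = 2 * (gap a * X) / (gap a * h a)" .
  have cancel: "2 * y / (gap a * h a) = 2 * z / (gap a * h a) \<longleftrightarrow> y = z" for y z
    using pos by simp
  show ?thesis
    unfolding \<Delta>1 \<Delta>2 den num l d_eq[symmetric] rr critical_def N_def[symmetric] X_def[symmetric]
      cancel by (simp only: mult.commute)
qed

end

section \<open>Generalized inverses of information matrices\<close>

lemma info_matrix_mult:
  "(info_matrix p0 p1 p2 \<xi> *v u) $ i =
    (\<Sum>x\<in>set_pmf \<xi>. pmf \<xi> x * eff p0 p1 p2 x * (grad_resp p0 p1 p2 x \<bullet> u) * grad_resp p0 p1 p2 x $ i)"
proof -
  have "(info_matrix p0 p1 p2 \<xi> *v u) $ i =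
      (\<Sum>j\<in>UNIV. \<Sum>x\<in>set_pmf \<xi>.
        pmf \<xi> x * eff p0 p1 p2 x * grad_resp p0 p1 p2 x $ i * grad_resp p0 p1 p2 x $ j * u $ j)"
    by (simp add: matrix_vector_mult_def info_matrix_def sum_distrib_right)
  also have "\<dots> = (\<Sum>x\<in>set_pmf \<xi>. \<Sum>j\<in>UNIV.
        pmf \<xi> x * eff p0 p1 p2 x * grad_resp p0 p1 p2 x $ i * grad_resp p0 p1 p2 x $ j * u $ j)"
    by (rule sum.swap)
  also have "\<dots> = (\<Sum>x\<in>set_pmf \<xi>.
      pmf \<xi> x * eff p0 p1 p2 x * (grad_resp p0 p1 p2 x \<bullet> u) * grad_resp p0 p1 p2 x $ i)"
    by (simp add: inner_vec_def sum_distrib_left sum_distrib_right mult_ac)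
  finally show ?thesis .
qed

lemma info_matrix_form:
  "v \<bullet> (info_matrix p0 p1 p2 \<xi> *v u) = (\<Sum>x\<in>set_pmf \<xi>.
     pmf \<xi> x * eff p0 p1 p2 x * (grad_resp p0 p1 p2 x \<bullet> u) * (grad_resp p0 p1 p2 x \<bullet> v))"
proof -
  have "v \<bullet> (info_matrix p0 p1 p2 \<xi> *v u) =
    (\<Sum>j\<in>UNIV. \<Sum>x\<in>set_pmf \<xi>.
     pmf \<xi> x * eff p0 p1 p2 x * (grad_resp p0 p1 p2 x \<bullet> u) * grad_resp p0 p1 p2 x $ j * v $ j)"
    by (simp add: inner_vec_def[of v] info_matrix_mult sum_distrib_left mult_ac)
  also have "\<dots> = (\<Sum>x\<in>set_pmf \<xi>. \<Sum>j\<in>UNIV.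
     pmf \<xi> x * eff p0 p1 p2 x * (grad_resp p0 p1 p2 x \<bullet> u) * grad_resp p0 p1 p2 x $ j * v $ j)"
    by (rule sum.swap)
  also have "\<dots> = (\<Sum>x\<in>set_pmf \<xi>.
     pmf \<xi> x * eff p0 p1 p2 x * (grad_resp p0 p1 p2 x \<bullet> u) * (grad_resp p0 p1 p2 x \<bullet> v))"
    by (simp add: inner_vec_def[of _ v] sum_distrib_left mult_ac)
  finally show ?thesis .
qed

lemma info_matrix_symmetric: "v \<bullet> (info_matrix p0 p1 p2 \<xi> *v u) = u \<bullet> (info_matrix p0 p1 p2 \<xi> *v v)"
  by (simp add: info_matrix_form mult_ac)

text \<open>Writing the first unit vector as \<open>M *v v\<close> places \<open>G\<close> between
  two copies of \<open>M\<close>, where it drops out and leaves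
  \<open>v \<bullet> (M *v v)\<close>.\<close>

lemma ginverse_11:
  assumes v: "info_matrix p0 p1 p2 \<xi> *v v = axis 1 1"
  shows "ginverse (info_matrix p0 p1 p2 \<xi>) $ 1 $ 1 = v $ 1"
proof -
  define M where "M = info_matrix p0 p1 p2 \<xi>"
  define G where "G = ginverse M"
  have v': "M *v v = axis 1 1" using v by (simp add: M_def)
  have "G $ 1 $ 1 = axis 1 1 \<bullet> (G *v axis 1 1)"
    by (simp add: inner_axis' matrix_vector_mult_basis column_def)
  also have "\<dots> = (G *v (M *v v)) \<bullet> (M *v v)" unfolding v' by (rule inner_commute)
  also have "\<dots> = v \<bullet> (M *v (G *v (M *v v)))"
    unfolding M_def by (rule info_matrix_symmetric)
  also have "\<dots> = v \<bullet> (M *v v)"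
    using is_ginverse_ginverse[of M]
    by (simp add: is_ginverse_def G_def matrix_vector_mul_assoc matrix_mul_assoc)
  also have "\<dots> = v $ 1" unfolding v' by (simp add: inner_axis)
  finally show ?thesis by (simp add: G_def M_def)
qed

text \<open>Weak duality, by expanding the nonnegative quadratic form at \<open>u - E *\<^sub>R v\<close>.\<close>

lemma variance_bound:
  assumes fin: "finite (set_pmf \<xi>)" and v: "info_matrix p0 p1 p2 \<xi> *v v = axis 1 1"
    and u: "u $ 1 = 1" and E: "E > 0"
    and pos: "\<forall>x\<in>set_pmf \<xi>. eff p0 p1 p2 x > 0"
    and bound: "\<forall>x\<in>set_pmf \<xi>. eff p0 p1 p2 x * (grad_resp p0 p1 p2 x \<bullet> u)\<^sup>2 \<le> E"
  shows "1 / E \<le> v $ 1"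
    and "v $ 1 \<le> 1 / E \<Longrightarrow> info_matrix p0 p1 p2 \<xi> *v u = axis 1 E"
    and "v $ 1 \<le> 1 / E \<Longrightarrow> x \<in> set_pmf \<xi> \<Longrightarrow> eff p0 p1 p2 x * (grad_resp p0 p1 p2 x \<bullet> u)\<^sup>2 = E"
proof -
  define M where "M = info_matrix p0 p1 p2 \<xi>"
  define f where "f = grad_resp p0 p1 p2"
  define z where "z = u - E *\<^sub>R v"
  have v': "M *v v = axis 1 1" using v by (simp add: M_def)
  have Mz: "M *v z = M *v u - axis 1 E"
    unfolding z_def matrix_vector_mult_diff_distrib matrix_vector_mult_scaleR v'
    by (simp add: axis_def vec_eq_iff)
  have uv: "v \<bullet> (M *v u) = 1"
    using info_matrix_symmetric[of v p0 p1 p2 \<xi> u] v' u by (simp add: M_def inner_axis)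
  have sum1: "(\<Sum>x\<in>set_pmf \<xi>. pmf \<xi> x) = 1" using sum_pmf_eq_1[OF fin] by simp
  \<comment> \<open>The weights sum to 1, so this is the weighted mean of the slacks in
    \<open>bound\<close>.\<close>
  have gap: "E - u \<bullet> (M *v u) = (\<Sum>x\<in>set_pmf \<xi>. pmf \<xi> x * (E - eff p0 p1 p2 x * (f x \<bullet> u)\<^sup>2))"
    using sum1 by (simp add: M_def f_def info_matrix_form right_diff_distrib sum_subtractf
        power2_eq_square mult_ac flip: sum_distrib_left)
  have gap_terms: "pmf \<xi> x * (E - eff p0 p1 p2 x * (f x \<bullet> u)\<^sup>2) \<ge> 0" if "x \<in> set_pmf \<xi>" for x
    using bspec[OF bound that] by (simp add: f_def)
  have gap_nonneg: "E - u \<bullet> (M *v u) \<ge> 0"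
    unfolding gap by (rule sum_nonneg[OF gap_terms])
  have zz: "z \<bullet> (M *v z) = (\<Sum>x\<in>set_pmf \<xi>. pmf \<xi> x * eff p0 p1 p2 x * (f x \<bullet> z)\<^sup>2)"
    by (simp add: M_def f_def info_matrix_form power2_eq_square mult_ac)
  have z_terms: "pmf \<xi> x * eff p0 p1 p2 x * (f x \<bullet> z)\<^sup>2 \<ge> 0" if "x \<in> set_pmf \<xi>" for x
    using bspec[OF pos that] by simp
  have zz_nonneg: "z \<bullet> (M *v z) \<ge> 0" unfolding zz by (rule sum_nonneg[OF z_terms])
  have expand: "z \<bullet> (M *v z) = u \<bullet> (M *v u) - 2 * E + E * E * v $ 1"
    unfolding Mz unfolding z_def using uv u
    by (simp add: inner_axis algebra_simps)
  have "E * 1 \<le> E * (E * v $ 1)" using expand gap_nonneg zz_nonneg by (simp add: mult.assoc)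
  then have "1 \<le> E * v $ 1" using E by (rule mult_left_le_imp_le)
  then show "1 / E \<le> v $ 1" using E by (simp add: field_simps)
  {
    assume "v $ 1 \<le> 1 / E"
    then have "E * v $ 1 \<le> 1" using E by (simp add: field_simps)
    then have "E * (E * v $ 1) \<le> E * 1" using E by (intro mult_left_mono) auto
    \<comment> \<open>In the equality case both nonnegative quantities vanish, hence each of their
      summands.\<close>
    then have 0: "z \<bullet> (M *v z) = 0" "E - u \<bullet> (M *v u) = 0"
      using expand gap_nonneg zz_nonneg by (simp_all add: mult.assoc)
    have fz: "f x \<bullet> z = 0" if "x \<in> set_pmf \<xi>" for x
    proof -
      have "pmf \<xi> x * eff p0 p1 p2 x * (f x \<bullet> z)\<^sup>2 = 0"
        by (rule sum_nonneg_0[OF fin z_terms 0(1)[unfolded zz] that])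
      then show ?thesis using bspec[OF pos that] that by (auto simp: set_pmf_iff)
    qed
    have "M *v z = 0"
      using fz by (simp add: vec_eq_iff M_def info_matrix_mult f_def)
    then show "info_matrix p0 p1 p2 \<xi> *v u = axis 1 E" using Mz by (simp add: M_def)
    show "eff p0 p1 p2 x * (grad_resp p0 p1 p2 x \<bullet> u)\<^sup>2 = E" if "x \<in> set_pmf \<xi>"
    proof -
      have "pmf \<xi> x * (E - eff p0 p1 p2 x * (f x \<bullet> u)\<^sup>2) = 0"
        by (rule sum_nonneg_0[OF fin gap_terms 0(2)[unfolded gap] that])
      then show ?thesis using that by (auto simp: set_pmf_iff f_def)
    qed
  }
qed

text \<open>The signed masses \<open>b1, - b2, b3\<close> annihilate affine functions, so they are
  proportional to a second divided difference: \<open>b1 : b2 : b3\<close> is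
  \<open>t2 - t3 : t1 - t3 : t1 - t2\<close>. The normalization \<open>one\<close> fixes the
  factor.\<close>

lemma alternating_weights:
  fixes t1 t2 t3 b1 b2 b3 h1 h2 h3 :: real
  assumes t: "t1 > t2" "t2 > t3" and h: "h1 > 0" "h2 > 0" "h3 > 0"
    and eq: "b1 + b3 = b2" "b1 * t1 + b3 * t3 = b2 * t2"
    and one: "b1 * h1 + b2 * h2 + b3 * h3 = 1"
  defines "S \<equiv> h1 * (t2 - t3) + h2 * (t1 - t3) + h3 * (t1 - t2)"
  shows "b1 * h1 = h1 * (t2 - t3) / S" "b2 * h2 = h2 * (t1 - t3) / S" "b3 * h3 = h3 * (t1 - t2) / S"
proof -
  have S: "S > 0" unfolding S_def using t h by (intro add_pos_pos mult_pos_pos) auto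
  have "b1 * (t1 - t3) = (b1 * t1 + b3 * t3) - (b1 + b3) * t3"
    "b3 * (t1 - t3) = (b1 + b3) * t1 - (b1 * t1 + b3 * t3)"
    by (simp_all add: algebra_simps)
  then have b: "b1 * (t1 - t3) = b2 * (t2 - t3)" "b3 * (t1 - t3) = b2 * (t1 - t2)"
    unfolding eq by (simp_all add: algebra_simps)
  have "t1 - t3 = (t1 - t3) * (b1 * h1 + b2 * h2 + b3 * h3)" using one by simp
  also have "\<dots> = (b1 * (t1 - t3)) * h1 + b2 * (t1 - t3) * h2 + (b3 * (t1 - t3)) * h3"
    by (simp add: algebra_simps)
  also have "\<dots> = b2 * S" unfolding b S_def by (simp add: algebra_simps)
  finally have T: "t1 - t3 = b2 * S" .
  have "t1 - t3 > 0" using t by simp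
  then have b2: "b2 \<noteq> 0" using T by auto
  have "b2 * (b1 * S) = b2 * (t2 - t3)" "b2 * (b3 * S) = b2 * (t1 - t2)"
    using b unfolding T by (simp_all add: mult_ac)
  then have "b1 * S = t2 - t3" "b3 * S = t1 - t2" using b2 by auto
  then have "b1 = (t2 - t3) / S" "b2 = (t1 - t3) / S" "b3 = (t1 - t2) / S"
    using S T by (simp_all add: eq_divide_eq)
  then show "b1 * h1 = h1 * (t2 - t3) / S" "b2 * h2 = h2 * (t1 - t3) / S" "b3 * h3 = h3 * (t1 - t2) / S"
    by simp_all
qed

section \<open>Optimal designs\<close>

locale group_testing =
  fixes p0 p1 p2 xL xU :: real
  assumes p0: "0 < p0" "p0 < 1" and p1: "1/2 < p1" "p1 \<le> 1" and p2: "1/2 < p2" "p2 \<le> 1"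
    and xL: "1 \<le> xL" and xLU: "xL < xU"
begin

abbreviation c where "c \<equiv> c_const p0 p1 p2 xL"
abbreviation r where "r \<equiv> r_const p0 xL xU"

definition s :: real where "s = p1 + p2 - 1"

definition q :: real where "q = 1 - p0"

lemma s_pos: "0 < s" using p1 p2 by (simp add: s_def)

lemma q_bounds: "0 < q" "q < 1" using p0 by (auto simp: q_def)

lemma ln_q: "ln q < 0" using q_bounds by simp

lemma q_powr_less_1: "0 < x \<Longrightarrow> q powr x < 1"
  using q_bounds ln_q by (simp add: powr_def mult_pos_neg)

lemma c_eq: "c = p1 / (s * q powr xL)" by (simp add: c_const_def s_def q_def)

lemma c_gt_1: "1 < c"
proof -
  have "q powr xL < 1" using q_powr_less_1 xL by simp
  then have "s * q powr xL < s * 1" using s_pos by (intro mult_strict_left_mono)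
  also have "s \<le> p1" using p2 by (simp add: s_def)
  finally show ?thesis using s_pos q_bounds by (simp add: c_eq)
qed

lemma r_bounds: "0 < r" "r < 1"
  using q_bounds xLU q_powr_less_1[of "xU - xL"] by (auto simp: r_const_def q_def)

sublocale weighted_chebyshev c "\<delta>_const p1 * c" r
  using c_gt_1 r_bounds p1 by unfold_locales (auto simp: \<delta>_const_def)

text \<open>Carries \<open>[xL, xU]\<close> to \<open>[r, 1]\<close> in reverse order, the smallest
  group size going to \<open>1\<close>.\<close>

definition arg :: "real \<Rightarrow> real" where "arg x = q powr (x - xL)"

lemma powr_arg: "q powr x = q powr xL * arg x"
  by (simp add: arg_def flip: powr_add)

lemma arg_ends: "arg xL = 1" "arg xU = r"
  using q_bounds by (auto simp: arg_def r_const_def q_def)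

lemma arg_less: "arg x < arg y \<longleftrightarrow> y < x"
  unfolding arg_def using q_bounds powr_less_mono'[of q "y - xL" "x - xL"]
    powr_less_mono'[of q "x - xL" "y - xL"] by (cases x y rule: linorder_cases) auto

lemma arg_inj: "arg x = arg y \<longleftrightarrow> x = y"
  using arg_less[of x y] arg_less[of y x] by (cases x y rule: linorder_cases) auto

lemma arg_range: "x \<in> {xL..xU} \<Longrightarrow> r \<le> arg x \<and> arg x \<le> 1"
  using arg_less[of x xU] arg_less[of xL x] arg_ends by (simp add: not_less[symmetric])

definition K :: real where "K = (s * q powr xL)\<^sup>2"

lemma K_pos: "0 < K" using s_pos q_bounds by (simp add: K_def)

text \<open>The constants are scaled so that the response probability and its complement are
  \<open>s * q powr xL\<close> times the two affine factors of \<open>g\<close>.\<close>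

lemma inverse_eff: "inverse (eff p0 p1 p2 x) = K * g (arg x)"
proof -
  have T: "s * q powr xL \<noteq> 0" using s_pos q_bounds by simp
  have "resp_prob p0 p1 p2 x = s * q powr xL * (c - arg x)"
    using T powr_arg[of x] by (simp add: resp_prob_def c_eq s_def q_def right_diff_distrib)
  moreover have "1 - resp_prob p0 p1 p2 x = s * q powr xL * (\<delta>_const p1 * c + arg x)"
    using T powr_arg[of x] p1
    by (simp add: resp_prob_def c_eq s_def[symmetric] q_def[symmetric] \<delta>_const_def field_simps)
  ultimately show ?thesis by (simp add: eff_def K_def g_def power2_eq_square)
qed

lemma eff_eq: "eff p0 p1 p2 x = inverse (K * g (arg x))"
  by (metis inverse_eff inverse_inverse_eq)

lemma eff_pos: "x \<in> {xL..xU} \<Longrightarrow> 0 < eff p0 p1 p2 x"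
  using K_pos g_pos arg_range[of x] by (simp add: eff_eq)

lemma sqrt_inverse_eff: "sqrt (inverse (eff p0 p1 p2 x)) = sqrt K * h (arg x)"
  by (simp add: inverse_eff h_def real_sqrt_mult)

text \<open>The coefficient of \<open>arg x * ln (arg x)\<close> in the first gradient component
  after substituting \<open>x = xL + ln (arg x) / ln q\<close>.\<close>

definition C :: real where "C = s * q powr xL / (q * ln q)"

lemma C_nonzero: "C \<noteq> 0" using s_pos q_bounds ln_q by (simp add: C_def)

text \<open>\<open>b0\<close> and \<open>b1\<close> are the coefficients of the affine part of
  \<open>\<psi> e\<close>. The third entry also cancels the unwanted multiples of
  \<open>arg x\<close> from the first two gradient components.\<close>

definition dual :: "real \<Rightarrow> real ^ 3" where
  "dual e = (let b0 = e * (h 1 - slope) - \<Delta>0 r; b1 = e * slope + \<Delta>0 r in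
     vector [1, C * b0, s * xL / q - C * b1 / q powr xL - C * b0])"

lemma dual_1: "dual e $ 1 = 1" by (simp add: dual_def Let_def)

lemma grad_resp_dual: "grad_resp p0 p1 p2 x \<bullet> dual e = C * \<psi> e (arg x)"
proof -
  have T: "q powr xL > 0" using q_bounds by simp
  have ln: "ln (arg x) = (x - xL) * ln q" using q_bounds by (simp add: arg_def)
  have "q powr (x - 1) = q powr x / q" using q_bounds by (simp add: powr_diff)
  then have g1: "grad_resp p0 p1 p2 x $ 1 = x * s * q powr xL * arg x / q"
    by (simp add: grad_resp_def s_def q_def[symmetric] powr_arg[of x])
  have "xL + ln (arg x) / ln q = x" using ln ln_q by simp
  then have "x * s * q powr xL * arg x / q = (xL + ln (arg x) / ln q) * s * q powr xL * arg x / q"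
    by simp
  also have "\<dots> = s * xL / q * (q powr xL * arg x) + C * (arg x * ln (arg x))"
    by (simp add: C_def add_divide_distrib algebra_simps)
  finally have g1': "grad_resp p0 p1 p2 x $ 1 = s * xL / q * (q powr xL * arg x) + C * (arg x * ln (arg x))"
    using g1 by simp
  have g23: "grad_resp p0 p1 p2 x $ 2 = 1 - q powr xL * arg x"
    "grad_resp p0 p1 p2 x $ 3 = - (q powr xL * arg x)"
    using powr_arg[of x] by (auto simp: grad_resp_def q_def)
  define b0 b1 where "b0 = e * (h 1 - slope) - \<Delta>0 r" and "b1 = e * slope + \<Delta>0 r"
  have d: "dual e $ 2 = C * b0" "dual e $ 3 = s * xL / q - C * b1 / q powr xL - C * b0"
    by (simp_all add: dual_def Let_def b0_def b1_def)
  have "grad_resp p0 p1 p2 x \<bullet> dual e = C * (arg x * ln (arg x) + b0 + b1 * arg x)"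
    using T by (simp add: inner_vec_def sum_3 g1' g23 d dual_1 algebra_simps)
  also have "arg x * ln (arg x) + b0 + b1 * arg x = \<psi> e (arg x)"
    by (simp add: \<psi>_def gap_def chord_affine b0_def b1_def algebra_simps)
  finally show ?thesis .
qed

section \<open>The dual certificate at the maximizer of \<open>\<rho>\<close>\<close>

context
  fixes m :: real
  assumes m: "r < m" "m < 1" and max: "\<forall>y\<in>{r..1}. \<rho> y \<le> \<rho> m"
begin

definition x2 :: real where "x2 = xL + ln m / ln q"

text \<open>The maximum over \<open>[xL, xU]\<close> of the weighted squared error of the dual
  vector at level \<open>\<rho> m\<close>; its reciprocal is the optimal variance.\<close>

definition E :: real where "E = C\<^sup>2 * (\<rho> m)\<^sup>2 / K"

abbreviation u where "u \<equiv> dual (\<rho> m)"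

lemma arg_x2: "arg x2 = m"
  using q_bounds ln_q m r_bounds by (simp add: arg_def x2_def powr_def)

lemma x2_between: "xL < x2" "x2 < xU"
  using arg_less[of x2 xL] arg_less[of xU x2] arg_x2 arg_ends m by auto

lemma E_pos: "0 < E"
  using C_nonzero K_pos \<rho>_pos[OF m] by (simp add: E_def)

text \<open>The excess over \<open>E\<close> carries the sign of \<open>F\<close>, so
  \<open>F_maximizer\<close> yields both the bound and its equality points.\<close>

lemma eff_dual:
  assumes "x \<in> {xL..xU}"
  shows "eff p0 p1 p2 x * (grad_resp p0 p1 p2 x \<bullet> u)\<^sup>2 = E + C\<^sup>2 * F (\<rho> m) (arg x) / (K * g (arg x))"
proof -
  have "g (arg x) > 0" using g_pos arg_range[OF assms] by simp
  then show ?thesis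
    using K_pos unfolding eff_eq grad_resp_dual E_def F_def
    by (simp add: field_simps)
qed

lemma eff_dual_le:
  assumes "x \<in> {xL..xU}"
  shows "eff p0 p1 p2 x * (grad_resp p0 p1 p2 x \<bullet> u)\<^sup>2 \<le> E"
proof -
  have "C\<^sup>2 * F (\<rho> m) (arg x) / (K * g (arg x)) \<le> 0"
    using F_maximizer(1)[OF m max, of "arg x"] arg_range[OF assms] g_pos[of "arg x"] K_pos
    by (intro divide_nonpos_pos mult_nonneg_nonpos) auto
  then show ?thesis using eff_dual[OF assms] by simp
qed

lemma eff_dual_eq:
  assumes "x \<in> {xL..xU}" "eff p0 p1 p2 x * (grad_resp p0 p1 p2 x \<bullet> u)\<^sup>2 = E"
  shows "x \<in> {xL, x2, xU}"
proof -
  have "F (\<rho> m) (arg x) = 0"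
    using eff_dual[OF assms(1)] assms arg_range[OF assms(1)] g_pos[of "arg x"] K_pos C_nonzero
    by simp
  then have "arg x \<in> {r, m, 1}"
    using F_maximizer(2)[OF m max, of "arg x"] arg_range[OF assms(1)] by simp
  then show ?thesis using arg_inj arg_ends arg_x2 by (metis insert_iff singletonD)
qed

section \<open>The candidate design and its weights\<close>

definition S :: real where
  "S = sqrt (Q1 p0 p1 p2 xL x2 xU) + sqrt (Q2 p0 p1 p2 xL x2 xU) + sqrt (Q3 p0 p1 p2 xL x2 xU)"

definition has_weights :: "real pmf \<Rightarrow> bool" where
  "has_weights \<xi> \<longleftrightarrow> set_pmf \<xi> = {xL, x2, xU} \<and>
     pmf \<xi> xL = sqrt (Q1 p0 p1 p2 xL x2 xU) / S \<and>
     pmf \<xi> x2 = sqrt (Q2 p0 p1 p2 xL x2 xU) / S \<and>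
     pmf \<xi> xU = sqrt (Q3 p0 p1 p2 xL x2 xU) / S"

lemma powr_diff_eq: "(1 - p0) powr x - (1 - p0) powr y = q powr xL * (arg x - arg y)"
  using powr_arg[of x] powr_arg[of y] by (simp add: q_def right_diff_distrib)

text \<open>The roots of the squares are positive differences because \<open>1 > m > r\<close>; the
  common factor \<open>sqrt K * q powr xL\<close> cancels in the weights.\<close>

lemma sqrt_Q:
  "sqrt (Q1 p0 p1 p2 xL x2 xU) = sqrt K * q powr xL * (h 1 * (m - r))"
  "sqrt (Q2 p0 p1 p2 xL x2 xU) = sqrt K * q powr xL * (h m * (1 - r))"
  "sqrt (Q3 p0 p1 p2 xL x2 xU) = sqrt K * q powr xL * (h r * (1 - m))"
  using m q_bounds
  by (simp_all add: Q1_def Q2_def Q3_def real_sqrt_mult sqrt_inverse_eff powr_diff_eq arg_ends arg_x2)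

lemma sqrt_Q_pos:
  "0 < sqrt (Q1 p0 p1 p2 xL x2 xU)" "0 < sqrt (Q2 p0 p1 p2 xL x2 xU)"
  "0 < sqrt (Q3 p0 p1 p2 xL x2 xU)"
  unfolding sqrt_Q using m q_bounds r_bounds K_pos h_pos[of 1] h_pos[of m] h_pos[of r] by simp_all

lemma S_pos: "0 < S"
  unfolding S_def using sqrt_Q_pos by (intro add_pos_pos)

lemma weight_ratio:
  "sqrt (Q1 p0 p1 p2 xL x2 xU) / S = h 1 * (m - r) / (h 1 * (m - r) + h m * (1 - r) + h r * (1 - m))"
  "sqrt (Q2 p0 p1 p2 xL x2 xU) / S = h m * (1 - r) / (h 1 * (m - r) + h m * (1 - r) + h r * (1 - m))"
  "sqrt (Q3 p0 p1 p2 xL x2 xU) / S = h r * (1 - m) / (h 1 * (m - r) + h m * (1 - r) + h r * (1 - m))"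
  using K_pos q_bounds unfolding S_def sqrt_Q distrib_left[symmetric] by simp_all

lemma distinct_points: "xL \<noteq> x2" "xL \<noteq> xU" "x2 \<noteq> xU"
  using x2_between by auto

lemma sum_support:
  assumes "set_pmf \<xi> \<subseteq> {xL, x2, xU}"
  shows "(\<Sum>x\<in>set_pmf \<xi>. pmf \<xi> x * G x) = pmf \<xi> xL * G xL + pmf \<xi> x2 * G x2 + pmf \<xi> xU * G xU"
proof -
  have "(\<Sum>x\<in>set_pmf \<xi>. pmf \<xi> x * G x) = (\<Sum>x\<in>{xL, x2, xU}. pmf \<xi> x * G x)"
    using assms by (intro sum.mono_neutral_left) (auto simp: set_pmf_iff)
  then show ?thesis using distinct_points by simp
qed

lemma sum_pmf_support:
  assumes "set_pmf \<xi> \<subseteq> {xL, x2, xU}"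
  shows "pmf \<xi> xL + pmf \<xi> x2 + pmf \<xi> xU = 1"
  using sum_support[OF assms, of "\<lambda>_. 1"] sum_pmf_eq_1[of "set_pmf \<xi>" \<xi>] finite_subset[OF assms]
  by simp

text \<open>At the three points the error alternates between \<open>+\<close> and \<open>-\<close>
  the height \<open>\<rho> m * h\<close>, while \<open>eff\<close> contributes the inverse square of
  \<open>h\<close>.\<close>

lemma info_matrix_dual:
  assumes "set_pmf \<xi> \<subseteq> {xL, x2, xU}"
  shows "(info_matrix p0 p1 p2 \<xi> *v u) $ i = C * \<rho> m / K *
    (pmf \<xi> xL / h 1 * grad_resp p0 p1 p2 xL $ i - pmf \<xi> x2 / h m * grad_resp p0 p1 p2 x2 $ i
     + pmf \<xi> xU / h r * grad_resp p0 p1 p2 xU $ i)"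
proof -
  have pos: "h 1 > 0" "h r > 0" "h m > 0" using h_pos m r_bounds by simp_all
  have "inverse (K * (h a)\<^sup>2) * (C * (\<rho> m * h a)) = C * \<rho> m / K / h a" if "h a > 0" for a
    using that K_pos by (simp add: field_simps power2_eq_square)
  note * = this[OF pos(1)] this[OF pos(2)] this[OF pos(3)]
  have sq: "g 1 = (h 1)\<^sup>2" "g r = (h r)\<^sup>2" "g m = (h m)\<^sup>2"
    using h_square m r_bounds by simp_all
  have w: "eff p0 p1 p2 xL * (grad_resp p0 p1 p2 xL \<bullet> u) = C * \<rho> m / K / h 1"
    "eff p0 p1 p2 xU * (grad_resp p0 p1 p2 xU \<bullet> u) = C * \<rho> m / K / h r"
    "eff p0 p1 p2 x2 * (grad_resp p0 p1 p2 x2 \<bullet> u) = - (C * \<rho> m / K / h m)"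
    using * m by (simp_all add: eff_eq grad_resp_dual arg_ends arg_x2 \<psi>_ends \<psi>_touch sq)
  have "(info_matrix p0 p1 p2 \<xi> *v u) $ i = (\<Sum>x\<in>set_pmf \<xi>. pmf \<xi> x *
      (eff p0 p1 p2 x * (grad_resp p0 p1 p2 x \<bullet> u) * grad_resp p0 p1 p2 x $ i))"
    by (simp add: info_matrix_mult mult_ac)
  also have "\<dots> = C * \<rho> m / K *
    (pmf \<xi> xL / h 1 * grad_resp p0 p1 p2 xL $ i - pmf \<xi> x2 / h m * grad_resp p0 p1 p2 x2 $ i
     + pmf \<xi> xU / h r * grad_resp p0 p1 p2 xU $ i)"
    unfolding sum_support[OF assms] w by (simp add: algebra_simps)
  finally show ?thesis .
qed

lemma grad_resp_arg:
  "grad_resp p0 p1 p2 x $ 2 = 1 - q powr xL * arg x" "grad_resp p0 p1 p2 x $ 3 = - (q powr xL * arg x)"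
  using powr_arg[of x] by (auto simp: grad_resp_def q_def)

text \<open>The second and third gradient components span the affine functions of
  \<open>arg x\<close>, so the signed masses must annihilate \<open>1\<close> and
  \<open>arg x\<close>.\<close>

lemma balance_iff:
  assumes "set_pmf \<xi> \<subseteq> {xL, x2, xU}"
  shows "(info_matrix p0 p1 p2 \<xi> *v u) $ 2 = 0 \<and> (info_matrix p0 p1 p2 \<xi> *v u) $ 3 = 0 \<longleftrightarrow>
    pmf \<xi> xL / h 1 + pmf \<xi> xU / h r = pmf \<xi> x2 / h m \<and>
    pmf \<xi> xL / h 1 * 1 + pmf \<xi> xU / h r * r = pmf \<xi> x2 / h m * m"
proof -
  define b1 b2 b3 T where "b1 = pmf \<xi> xL / h 1" and "b2 = pmf \<xi> x2 / h m" and "b3 = pmf \<xi> xU / h r"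
    and "T = q powr xL"
  have T: "T > 0" using q_bounds by (simp add: T_def)
  have k: "C * \<rho> m / K * y = 0 \<longleftrightarrow> y = 0" for y using C_nonzero K_pos \<rho>_pos[OF m] by simp
  have "b1 * - (T * 1) - b2 * - (T * m) + b3 * - (T * r) = - T * (b1 * 1 + b3 * r - b2 * m)"
    by (simp add: algebra_simps)
  then have 3: "b1 * - (T * 1) - b2 * - (T * m) + b3 * - (T * r) = 0 \<longleftrightarrow> b1 * 1 + b3 * r = b2 * m"
    using T by simp
  \<comment> \<open>Given the first-moment condition, the second component leaves only the condition
    on the total mass.\<close>
  have "b1 * (1 - T * 1) - b2 * (1 - T * m) + b3 * (1 - T * r)
      = (b1 + b3 - b2) - T * (b1 * 1 + b3 * r - b2 * m)"
    by (simp add: algebra_simps)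
  then have 2: "b1 * (1 - T * 1) - b2 * (1 - T * m) + b3 * (1 - T * r) = 0 \<longleftrightarrow> b1 + b3 = b2"
    if "b1 * 1 + b3 * r = b2 * m" using that by simp
  show ?thesis
    unfolding info_matrix_dual[OF assms] grad_resp_arg arg_ends arg_x2
      b1_def[symmetric] b2_def[symmetric] b3_def[symmetric] T_def[symmetric] k 3
    using 2 by blast
qed

lemma weights_if_balanced:
  assumes sub: "set_pmf \<xi> \<subseteq> {xL, x2, xU}" and bal: "info_matrix p0 p1 p2 \<xi> *v u = axis 1 E"
  shows "has_weights \<xi>"
proof -
  have pos: "h 1 > 0" "h r > 0" "h m > 0" using h_pos m r_bounds by simp_all
  have "(info_matrix p0 p1 p2 \<xi> *v u) $ 2 = 0" "(info_matrix p0 p1 p2 \<xi> *v u) $ 3 = 0"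
    unfolding bal by (simp_all add: axis_def)
  then have eq: "pmf \<xi> xL / h 1 + pmf \<xi> xU / h r = pmf \<xi> x2 / h m"
    "pmf \<xi> xL / h 1 * 1 + pmf \<xi> xU / h r * r = pmf \<xi> x2 / h m * m"
    using balance_iff[OF sub] by auto
  have one: "pmf \<xi> xL / h 1 * h 1 + pmf \<xi> x2 / h m * h m + pmf \<xi> xU / h r * h r = 1"
    using sum_pmf_support[OF sub] pos by simp
  have w: "pmf \<xi> xL = sqrt (Q1 p0 p1 p2 xL x2 xU) / S"
    "pmf \<xi> x2 = sqrt (Q2 p0 p1 p2 xL x2 xU) / S"
    "pmf \<xi> xU = sqrt (Q3 p0 p1 p2 xL x2 xU) / S"
    using alternating_weights[OF m(2) m(1) pos(1) pos(3) pos(2) eq one] pos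
    unfolding weight_ratio by simp_all
  then have "pmf \<xi> xL > 0" "pmf \<xi> x2 > 0" "pmf \<xi> xU > 0" using sqrt_Q_pos S_pos by simp_all
  then have "set_pmf \<xi> = {xL, x2, xU}" using sub by (auto simp: set_pmf_iff)
  then show ?thesis using w by (simp add: has_weights_def)
qed

lemma balanced_if_weights:
  assumes "has_weights \<xi>"
  shows "info_matrix p0 p1 p2 \<xi> *v u = axis 1 E"
proof -
  have sub: "set_pmf \<xi> \<subseteq> {xL, x2, xU}" using assms by (simp add: has_weights_def)
  define D where "D = h 1 * (m - r) + h m * (1 - r) + h r * (1 - m)"
  have pos: "h 1 > 0" "h r > 0" "h m > 0" using h_pos m r_bounds by simp_all
  have w: "pmf \<xi> xL / h 1 = (m - r) / D" "pmf \<xi> x2 / h m = (1 - r) / D" "pmf \<xi> xU / h r = (1 - m) / D"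
    using assms pos unfolding has_weights_def weight_ratio D_def[symmetric] by simp_all
  have 23: "(info_matrix p0 p1 p2 \<xi> *v u) $ 2 = 0 \<and> (info_matrix p0 p1 p2 \<xi> *v u) $ 3 = 0"
  proof -
    have "(m - r) / D + (1 - m) / D = (1 - r) / D"
      by (simp flip: add_divide_distrib)
    moreover have "(m - r) / D * 1 + (1 - m) / D * r = (1 - r) / D * m"
      unfolding times_divide_eq_left add_divide_distrib[symmetric] by (simp add: algebra_simps)
    ultimately show ?thesis unfolding balance_iff[OF sub] w by simp
  qed
  \<comment> \<open>Since \<open>u $ 1 = 1\<close> and the other components of the image vanish, the
    first one is the form at \<open>u\<close>, a mean of values all equal to
    \<open>E\<close>.\<close>
  have "(info_matrix p0 p1 p2 \<xi> *v u) $ 1 = u \<bullet> (info_matrix p0 p1 p2 \<xi> *v u)"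
    using 23 by (simp add: inner_vec_def[of u] sum_3 dual_1)
  also have "\<dots> = (\<Sum>x\<in>set_pmf \<xi>. pmf \<xi> x * (eff p0 p1 p2 x * (grad_resp p0 p1 p2 x \<bullet> u)\<^sup>2))"
    by (simp add: info_matrix_form power2_eq_square mult_ac)
  also have "\<dots> = (\<Sum>x\<in>set_pmf \<xi>. pmf \<xi> x * E)"
  proof (intro sum.cong refl arg_cong2[where f = "(*)"])
    fix x assume "x \<in> set_pmf \<xi>"
    then have x: "x = xL \<or> x = x2 \<or> x = xU" using sub by auto
    have "F (\<rho> m) m = 0" using F_eq_0[OF _ m refl] \<rho>_pos[OF m] by simp
    then have "F (\<rho> m) (arg x) = 0" using x F_ends arg_ends arg_x2 by metis
    moreover have "x \<in> {xL..xU}" using x x2_between by auto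
    ultimately show "eff p0 p1 p2 x * (grad_resp p0 p1 p2 x \<bullet> u)\<^sup>2 = E"
      using eff_dual[of x] by simp
  qed
  also have "\<dots> = E"
    unfolding sum_support[OF sub] distrib_right[symmetric] sum_pmf_support[OF sub] by simp
  finally show ?thesis using 23 by (simp add: vec_eq_iff forall_3 axis_def)
qed

lemma has_weights_exists: "\<exists>\<xi>. has_weights \<xi>"
proof -
  define w1 w2 w3 where "w1 = sqrt (Q1 p0 p1 p2 xL x2 xU) / S"
    and "w2 = sqrt (Q2 p0 p1 p2 xL x2 xU) / S" and "w3 = sqrt (Q3 p0 p1 p2 xL x2 xU) / S"
  have pos: "w1 > 0" "w2 > 0" "w3 > 0" using sqrt_Q_pos S_pos by (simp_all add: w1_def w2_def w3_def)
  have "w1 + w2 + w3 = 1"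
    using S_pos unfolding w1_def w2_def w3_def add_divide_distrib[symmetric] by (simp add: S_def)
  then have wf: "pmf_of_list_wf [(xL, w1), (x2, w2), (xU, w3)]"
    using pos by (auto simp: pmf_of_list_wf_def)
  have "set_pmf (pmf_of_list [(xL, w1), (x2, w2), (xU, w3)]) = {xL, x2, xU}"
    using set_pmf_of_list_eq[OF wf] pos by auto
  then have "has_weights (pmf_of_list [(xL, w1), (x2, w2), (xU, w3)])"
    using distinct_points
    by (simp add: has_weights_def pmf_pmf_of_list[OF wf] w1_def[symmetric] w2_def[symmetric]
        w3_def[symmetric])
  then show ?thesis by blast
qed

lemma has_weights_unique: "has_weights \<xi> \<Longrightarrow> has_weights \<eta> \<Longrightarrow> \<xi> = \<eta>"
  by (rule pmf_eqI) (metis has_weights_def insert_iff pmf_eq_0_set_pmf singletonD)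

section \<open>Optimality and uniqueness of the design\<close>

lemma has_weights_design:
  assumes "has_weights \<xi>"
  shows "is_design xL xU \<xi>" "p0_estimable p0 p1 p2 \<xi>"
    "ginverse (info_matrix p0 p1 p2 \<xi>) $ 1 $ 1 = 1 / E"
proof -
  show "is_design xL xU \<xi>"
    using assms x2_between xLU by (simp add: has_weights_def is_design_def)
  \<comment> \<open>This preimage of the unit vector gives estimability and, by its first entry, the
    variance.\<close>
  have v: "info_matrix p0 p1 p2 \<xi> *v ((1 / E) *\<^sub>R u) = axis 1 1"
    unfolding matrix_vector_mult_scaleR balanced_if_weights[OF assms]
    using E_pos by (simp add: axis_def vec_eq_iff)
  show "p0_estimable p0 p1 p2 \<xi>" unfolding p0_estimable_def by (metis rangeI v)
  show "ginverse (info_matrix p0 p1 p2 \<xi>) $ 1 $ 1 = 1 / E"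
    using ginverse_11[OF v] by (simp add: dual_1)
qed

text \<open>Weak duality with \<open>u\<close>. Under equality, complementary slackness puts the
  support on the contact points, and the balance equations then determine the weights.\<close>

lemma design_bound:
  assumes "is_design xL xU \<xi>" "p0_estimable p0 p1 p2 \<xi>"
  shows "1 / E \<le> ginverse (info_matrix p0 p1 p2 \<xi>) $ 1 $ 1"
    and "ginverse (info_matrix p0 p1 p2 \<xi>) $ 1 $ 1 \<le> 1 / E \<Longrightarrow> has_weights \<xi>"
proof -
  have fin: "finite (set_pmf \<xi>)" and range: "\<And>x. x \<in> set_pmf \<xi> \<Longrightarrow> x \<in> {xL..xU}"
    using assms(1) by (auto simp: is_design_def)
  obtain v where v: "info_matrix p0 p1 p2 \<xi> *v v = axis 1 1"
    using assms(2) unfolding p0_estimable_def by (metis imageE)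
  have "\<forall>x\<in>set_pmf \<xi>. 0 < eff p0 p1 p2 x"
    "\<forall>x\<in>set_pmf \<xi>. eff p0 p1 p2 x * (grad_resp p0 p1 p2 x \<bullet> u)\<^sup>2 \<le> E"
    using eff_pos eff_dual_le range by blast+
  note bound = variance_bound[OF fin v dual_1 E_pos this]
  show "1 / E \<le> ginverse (info_matrix p0 p1 p2 \<xi>) $ 1 $ 1"
    using bound(1) ginverse_11[OF v] by simp
  assume "ginverse (info_matrix p0 p1 p2 \<xi>) $ 1 $ 1 \<le> 1 / E"
  then have le: "v $ 1 \<le> 1 / E" using ginverse_11[OF v] by simp
  have "set_pmf \<xi> \<subseteq> {xL, x2, xU}" using bound(3)[OF le] eff_dual_eq range by blast
  then show "has_weights \<xi>" using weights_if_balanced bound(2)[OF le] by blast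
qed

lemma Ds_optimal_iff: "Ds_optimal p0 p1 p2 xL xU \<xi> \<longleftrightarrow> has_weights \<xi>"
proof
  assume opt: "Ds_optimal p0 p1 p2 xL xU \<xi>"
  then have \<xi>: "is_design xL xU \<xi>" "p0_estimable p0 p1 p2 \<xi>" by (auto simp: Ds_optimal_def)
  obtain \<eta> where \<eta>: "has_weights \<eta>" using has_weights_exists by blast
  have "Phi_s (info_matrix p0 p1 p2 \<eta>) \<le> Phi_s (info_matrix p0 p1 p2 \<xi>)"
    using opt has_weights_design[OF \<eta>] by (auto simp: Ds_optimal_def)
  \<comment> \<open>Positivity turns the comparison of logarithms into one of variances.\<close>
  moreover have pos: "0 < 1 / E" using E_pos by simp
  moreover have "0 < ginverse (info_matrix p0 p1 p2 \<xi>) $ 1 $ 1"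
    using design_bound(1)[OF \<xi>] pos by linarith
  ultimately have "ginverse (info_matrix p0 p1 p2 \<xi>) $ 1 $ 1 \<le> 1 / E"
    using has_weights_design(3)[OF \<eta>] by (simp add: Phi_s_def)
  then show "has_weights \<xi>" by (rule design_bound(2)[OF \<xi>])
next
  assume \<xi>: "has_weights \<xi>"
  have "Phi_s (info_matrix p0 p1 p2 \<eta>) \<le> Phi_s (info_matrix p0 p1 p2 \<xi>)"
    if \<eta>: "is_design xL xU \<eta>" "p0_estimable p0 p1 p2 \<eta>" for \<eta>
  proof -
    have "0 < 1 / E" using E_pos by simp
    then show ?thesis
      using design_bound(1)[OF \<eta>] has_weights_design(3)[OF \<xi>] unfolding Phi_s_def
      by (metis ln_mono neg_le_iff_le)
  qed
  then show "Ds_optimal p0 p1 p2 xL xU \<xi>"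
    using has_weights_design[OF \<xi>] by (simp add: Ds_optimal_def)
qed

end

end

theorem theorem3:
  fixes p0 p1 p2 xL xU c \<delta> r :: real and Aeq :: "real \<Rightarrow> bool"
  assumes "0 < p0" "p0 < 1"
    and "1/2 < p1" "p1 \<le> 1"
    and "1/2 < p2" "p2 \<le> 1"
    and "1 \<le> xL" "xL < xU"
  defines "c \<equiv> c_const p0 p1 p2 xL"
    and "\<delta> \<equiv> \<delta>_const p1"
    and "r \<equiv> r_const p0 xL xU"
  defines "Aeq \<equiv> (\<lambda>a. 2 * (1 + \<Delta>1 c \<delta> r a) / a *
        (1 + (1 + \<Delta>0 r * (1 / a)) / (ln a - \<Delta>0 r * (1 / a - 1)))
      = 1 / (\<delta> * c + a) - 1 / (c - a) + 2 * \<Delta>2 c \<delta> r a)"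
  shows "(\<exists>!\<xi>. Ds_optimal p0 p1 p2 xL xU \<xi>) \<and>
    (\<exists>!a. a \<in> {r<..<1} \<and> Aeq a) \<and>
    (\<forall>\<xi> A x2 S. Ds_optimal p0 p1 p2 xL xU \<xi> \<longrightarrow>
       A \<in> {r<..<1} \<longrightarrow> Aeq A \<longrightarrow>
       x2 = xL + ln A / ln (1 - p0) \<longrightarrow>
       S = sqrt (Q1 p0 p1 p2 xL x2 xU) + sqrt (Q2 p0 p1 p2 xL x2 xU)
           + sqrt (Q3 p0 p1 p2 xL x2 xU) \<longrightarrow>
       xL < x2 \<and> x2 < xU \<and> set_pmf \<xi> = {xL, x2, xU} \<and>
       pmf \<xi> xL = sqrt (Q1 p0 p1 p2 xL x2 xU) / S \<and>
       pmf \<xi> x2 = sqrt (Q2 p0 p1 p2 xL x2 xU) / S \<and>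
       pmf \<xi> xU = sqrt (Q3 p0 p1 p2 xL x2 xU) / S)"
proof -
  interpret group_testing p0 p1 p2 xL xU by unfold_locales fact+
  \<comment> \<open>The same approximation problem, expressed in the constants of the
    statement.\<close>
  interpret W: weighted_chebyshev c "\<delta> * c" r
    unfolding c_def \<delta>_def r_def by (rule weighted_chebyshev_axioms)
  have Aeq: "Aeq a \<longleftrightarrow> W.critical a" if "a \<in> {r<..<1}" for a
    using W.critical_iff[of a \<delta>] that by (simp add: Aeq_def)
  obtain m where m: "r < m" "m < 1" and max: "\<forall>y\<in>{r..1}. W.\<rho> y \<le> W.\<rho> m"
    by (rule W.maximizer_exists)
  \<comment> \<open>The equation characterizes the critical points, and the maximizer is the only
    one.\<close>
  have uniq: "a \<in> {r<..<1} \<and> Aeq a \<longleftrightarrow> a = m" for a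
    using Aeq W.critical_unique[OF _ _ _ m max, of a] W.maximizer_critical[OF m max] m by auto
  note m' = m(1)[unfolded r_def] m(2) max[unfolded c_def \<delta>_def r_def]
  have opt: "Ds_optimal p0 p1 p2 xL xU \<xi> \<longleftrightarrow> has_weights m \<xi>" for \<xi>
    by (rule Ds_optimal_iff[OF m'])
  have ex1: "\<exists>!\<xi>. Ds_optimal p0 p1 p2 xL xU \<xi>"
    unfolding opt using has_weights_exists[OF m'] has_weights_unique[OF m'] by blast
  have ex1_a: "\<exists>!a. a \<in> {r<..<1} \<and> Aeq a"
    unfolding uniq by blast
  have weights: "xL < x2 \<and> x2 < xU \<and> set_pmf \<xi> = {xL, x2, xU} \<and>
       pmf \<xi> xL = sqrt (Q1 p0 p1 p2 xL x2 xU) / S \<and>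
       pmf \<xi> x2 = sqrt (Q2 p0 p1 p2 xL x2 xU) / S \<and>
       pmf \<xi> xU = sqrt (Q3 p0 p1 p2 xL x2 xU) / S"
    if "Ds_optimal p0 p1 p2 xL xU \<xi>" "A \<in> {r<..<1}" "Aeq A" and x2: "x2 = xL + ln A / ln (1 - p0)"
      and S: "S = sqrt (Q1 p0 p1 p2 xL x2 xU) + sqrt (Q2 p0 p1 p2 xL x2 xU)
           + sqrt (Q3 p0 p1 p2 xL x2 xU)" for \<xi> A x2 S
  proof -
    have "A = m" using uniq that by blast
    then have x2': "x2 = group_testing.x2 p0 xL m"
      using x2 by (simp add: x2_def[OF m'] q_def)
    show ?thesis
      using that(1) S x2_between[OF m'] unfolding opt has_weights_def[OF m'] S_def[OF m'] x2' by simp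
  qed
  show ?thesis
    by (rule conjI[OF ex1], rule conjI[OF ex1_a], intro allI impI, rule weights)
qed

end
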